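(* Let $(\mu_1,\mu_2)\in\mathbb{R}^2$ and let $\mathfrak{D}\subset\mathbb{R}^2$ be a simply connected domain with coordinates $(u,v)$. Let $(\omega^i)'=\xi^i\,du$ and $(\omega^i)''=\eta^i\,dv$, $i=0,1,2$, be smooth real $1$-forms on $\mathfrak{D}$ satisfying $$\partial''(\omega^0)'=\mu_1(\omega^1)''\wedge(\omega^1)'+\mu_2(\omega^2)''\wedge(\omega^2)',\qquad \partial''(\omega^i)'=\mu_i(\omega^i)''\wedge(\omega^0)'\quad(i=1,2),$$ $$\partial'(\omega^0)''=\mu_1(\omega^1)'\wedge(\omega^1)''+\mu_2(\omega^2)'\wedge(\omega^2)'',\qquad \partial'(\omega^i)''=\mu_i(\omega^i)'\wedge(\omega^0)''\quad(i=1,2).$$ Then $$\varphi(u,v)=\int\big((\omega^0)',\,e^{\mu_1x^0}(\omega^1)',\,e^{\mu_2x^0}(\omega^2)'\big)+\int\big((\omega^0)'',\,e^{\mu_1x^0}(\omega^1)'',\,e^{\mu_2x^0}(\omega^2)''\big)$$ is a well-defined harmonic map from $\mathfrak{D}$ into $G(\mu_1,\mu_2)$.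
   Context: For $(\mu_1,\mu_2)\in\mathbb{R}^2$, $G(\mu_1,\mu_2)$ denotes $\mathbb{R}^3$ with coordinates $(x^0,x^1,x^2)$, the group law $(x^0,x^1,x^2)\cdot(\tilde x^0,\tilde x^1,\tilde x^2)=(x^0+\tilde x^0,\,x^1+e^{\mu_1x^0}\tilde x^1,\,x^2+e^{\mu_2x^0}\tilde x^2)$ and the left-invariant Lorentzian metric $\langle\cdot,\cdot\rangle=-(dx^0)^2+e^{-2\mu_1x^0}(dx^1)^2+e^{-2\mu_2x^0}(dx^2)^2$. Exterior derivative: $d=\partial'+\partial''$, where $\partial'=\frac{\partial}{\partial u}du$ and $\partial''=\frac{\partial}{\partial v}dv$; so $\partial''(\xi\,du)=\xi_v\,dv\wedge du$ and $\partial'(\eta\,dv)=\eta_u\,du\wedge dv$. Meaning of the formula: the integrals are line integrals from a fixed base point of $\mathfrak{D}$ (with arbitrary constants of integration). Thus $\varphi=(x^0,x^1,x^2)$, where first $dx^0=(\omega^0)'+(\omega^0)''$ and then $dx^i=e^{\mu_ix^0}\big((\omega^i)'+(\omega^i)''\big)$ for $i=1,2$; $x^0$ in the formula is the first component of $\varphi$. Null coordinates are related to $(t,x)$ by $u=t+x$, $v=-t+x$. A smooth map $\varphi:\mathfrak{D}\to G(\mu_1,\mu_2)$ is harmonic if it is a critical point, with respect to smooth variations fixing $\varphi$ near the boundary (outside a compact subset, over which the energy is taken), of the energy $E(\varphi)=\int\frac12\big\{-\langle\varphi_t,\varphi_t\rangle+\langle\varphi_x,\varphi_x\rangle\big\}\,dt\,dx$.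 *)

theory Defs
  imports "HOL-Analysis.Analysis"
begin

section \<open>Smooth maps\<close>

text \<open>
  \<open>Ck_on k S f\<close>: on the open set \<open>S\<close>, \<open>f\<close> has iterated directional derivatives of all orders up
  to \<open>k\<close>, each continuous and, below order \<open>k\<close>, differentiable. On an open subset of a
  finite-dimensional space this is being of class C^k. It is meant for open \<open>S\<close> only.
\<close>

primrec Ck_on ::
  "nat \<Rightarrow> 'a set \<Rightarrow> ('a::real_normed_vector \<Rightarrow> 'b::real_normed_vector) \<Rightarrow> bool" where
  "Ck_on 0 S f \<longleftrightarrow> continuous_on S f"
| "Ck_on (Suc k) S f \<longleftrightarrow>
     (\<forall>x\<in>S. f differentiable (at x)) \<and> (\<forall>v. Ck_on k S (\<lambda>x. frechet_derivative f (at x) v))"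

definition smooth_on ::
  "'a set \<Rightarrow> ('a::real_normed_vector \<Rightarrow> 'b::real_normed_vector) \<Rightarrow> bool" where
  "smooth_on S f \<longleftrightarrow> (\<forall>k. Ck_on k S f)"

definition partial1 :: "(real \<times> real \<Rightarrow> 'b::real_normed_vector) \<Rightarrow> real \<times> real \<Rightarrow> 'b" where
  "partial1 f p = vector_derivative (\<lambda>s. f (s, snd p)) (at (fst p))"

definition partial2 :: "(real \<times> real \<Rightarrow> 'b::real_normed_vector) \<Rightarrow> real \<times> real \<Rightarrow> 'b" where
  "partial2 f p = vector_derivative (\<lambda>s. f (fst p, s)) (at (snd p))"


section \<open>Differential forms in the coordinates (u, v)\<close>

text \<open>
  A 1-form \<open>a du + b dv\<close> is the map \<open>p \<mapsto> (a p, b p)\<close>; a 2-form \<open>c du \<and> dv\<close> is its coefficient \<open>c\<close>.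
\<close>

type_synonym one_form = "real \<times> real \<Rightarrow> real \<times> real"
type_synonym two_form = "real \<times> real \<Rightarrow> real"

definition form_du :: "(real \<times> real \<Rightarrow> real) \<Rightarrow> one_form" where
  "form_du \<xi> = (\<lambda>p. (\<xi> p, 0))"

definition form_dv :: "(real \<times> real \<Rightarrow> real) \<Rightarrow> one_form" where
  "form_dv \<eta> = (\<lambda>p. (0, \<eta> p))"

definition wedge :: "one_form \<Rightarrow> one_form \<Rightarrow> two_form" where
  "wedge \<alpha> \<beta> = (\<lambda>p. fst (\<alpha> p) * snd (\<beta> p) - snd (\<alpha> p) * fst (\<beta> p))"

definition d' :: "one_form \<Rightarrow> two_form" where
  "d' \<alpha> = (\<lambda>p. partial1 (\<lambda>q. snd (\<alpha> q)) p)"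

text \<open>The sign comes from \<open>dv \<and> du = - du \<and> dv\<close>.\<close>

definition d'' :: "one_form \<Rightarrow> two_form" where
  "d'' \<alpha> = (\<lambda>p. - partial2 (\<lambda>q. fst (\<alpha> q)) p)"

text \<open>In this encoding, pairing a 1-form with a velocity vector is the inner product.\<close>

definition has_line_integral :: "one_form \<Rightarrow> real \<Rightarrow> (real \<Rightarrow> real \<times> real) \<Rightarrow> bool" where
  "has_line_integral \<alpha> I \<gamma> \<longleftrightarrow>
     ((\<lambda>s. \<alpha> (\<gamma> s) \<bullet> vector_derivative \<gamma> (at s within {0..1})) has_integral I) {0..1}"

text \<open>
  \<open>f = c + \<integral> \<alpha>\<close> on \<open>D\<close>, the line integral being taken from \<open>p0\<close>. It is required along every
  piecewise C^1 path in \<open>D\<close>, so that path independence is part of the notion.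
\<close>

definition is_integral_from ::
  "(real \<times> real) set \<Rightarrow> real \<times> real \<Rightarrow> real \<Rightarrow> one_form \<Rightarrow> (real \<times> real \<Rightarrow> real) \<Rightarrow> bool" where
  "is_integral_from D p0 c \<alpha> f \<longleftrightarrow>
     (\<forall>\<gamma>. valid_path \<gamma> \<and> path_image \<gamma> \<subseteq> D \<and> pathstart \<gamma> = p0 \<longrightarrow>
          has_line_integral \<alpha> (f (pathfinish \<gamma>) - c) \<gamma>)"


section \<open>The Lorentzian group G(\<mu>1, \<mu>2)\<close>

type_synonym G = "real \<times> real \<times> real"

fun G_mult :: "real \<Rightarrow> real \<Rightarrow> G \<Rightarrow> G \<Rightarrow> G" where
  "G_mult \<mu>1 \<mu>2 (x0, x1, x2) (y0, y1, y2) =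
     (x0 + y0, x1 + exp (\<mu>1 * x0) * y1, x2 + exp (\<mu>2 * x0) * y2)"

text \<open>\<open>G_metric \<mu>1 \<mu>2 x a b\<close> is the inner product of the tangent vectors \<open>a\<close>, \<open>b\<close> at \<open>x\<close>.\<close>

fun G_metric :: "real \<Rightarrow> real \<Rightarrow> G \<Rightarrow> G \<Rightarrow> G \<Rightarrow> real" where
  "G_metric \<mu>1 \<mu>2 (x0, x1, x2) (a0, a1, a2) (b0, b1, b2) =
     - (a0 * b0) + exp (- 2 * \<mu>1 * x0) * (a1 * b1) + exp (- 2 * \<mu>2 * x0) * (a2 * b2)"

lemma G_mult_has_derivative:
  "(G_mult \<mu>1 \<mu>2 g has_derivative
     (\<lambda>(a0, a1, a2). (a0, exp (\<mu>1 * fst g) * a1, exp (\<mu>2 * fst g) * a2))) (at x)"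
proof -
  obtain g0 g1 g2 where g: "g = (g0, g1, g2)" by (cases g)
  have "G_mult \<mu>1 \<mu>2 g = (\<lambda>y. (g0 + fst y, g1 + exp (\<mu>1 * g0) * fst (snd y),
          g2 + exp (\<mu>2 * g0) * snd (snd y)))"
    by (auto simp: g)
  moreover have "(\<dots> has_derivative
      (\<lambda>y. (fst y, exp (\<mu>1 * g0) * fst (snd y), exp (\<mu>2 * g0) * snd (snd y)))) (at x)"
    by (auto intro!: derivative_eq_intros)
  ultimately show ?thesis
    by (simp add: g case_prod_unfold)
qed

lemma G_metric_left_invariant:
  fixes \<mu>1 \<mu>2 :: real and g x a b :: G
  shows "G_metric \<mu>1 \<mu>2 (G_mult \<mu>1 \<mu>2 g x)
           (frechet_derivative (G_mult \<mu>1 \<mu>2 g) (at x) a)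
           (frechet_derivative (G_mult \<mu>1 \<mu>2 g) (at x) b)
           = G_metric \<mu>1 \<mu>2 x a b"
proof -
  have dL: "frechet_derivative (G_mult \<mu>1 \<mu>2 g) (at x) =
      (\<lambda>(a0, a1, a2). (a0, exp (\<mu>1 * fst g) * a1, exp (\<mu>2 * fst g) * a2))"
    by (rule frechet_derivative_at[OF G_mult_has_derivative, symmetric])
  have e: "exp (- 2 * \<mu> * (r + s)) * (exp (\<mu> * r) * y * (exp (\<mu> * r) * z))
             = exp (- 2 * \<mu> * s) * (y * z)" for \<mu> r s y z :: real
  proof -
    have "exp (- 2 * \<mu> * (r + s)) * (exp (\<mu> * r) * exp (\<mu> * r)) = exp (- 2 * \<mu> * s)"
      by (simp add: exp_add[symmetric] algebra_simps)
    then show ?thesis by (metis mult.assoc mult.left_commute)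
  qed
  show ?thesis
    unfolding dL
    by (cases g; cases x; cases a; cases b)
       (simp only: G_mult.simps G_metric.simps prod.case fst_conv e)
qed


section \<open>Harmonic maps into G(\<mu>1, \<mu>2)\<close>

definition null_coords :: "real \<times> real \<Rightarrow> real \<times> real" where
  "null_coords = (\<lambda>(t, x). (t + x, - t + x))"

definition energy_density :: "real \<Rightarrow> real \<Rightarrow> (real \<times> real \<Rightarrow> G) \<Rightarrow> real \<times> real \<Rightarrow> real" where
  "energy_density \<mu>1 \<mu>2 \<psi> p =
     1/2 * (- G_metric \<mu>1 \<mu>2 (\<psi> p) (partial1 \<psi> p) (partial1 \<psi> p)
            + G_metric \<mu>1 \<mu>2 (\<psi> p) (partial2 \<psi> p) (partial2 \<psi> p))"

text \<open>
  The map \<open>\<phi>\<close> and the set \<open>K\<close> live in the (u, v)-plane; derivatives and the integral are taken with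
  respect to (t, x).
\<close>

definition energy :: "real \<Rightarrow> real \<Rightarrow> (real \<times> real) set \<Rightarrow> (real \<times> real \<Rightarrow> G) \<Rightarrow> real" where
  "energy \<mu>1 \<mu>2 K \<phi> = integral (null_coords -` K) (energy_density \<mu>1 \<mu>2 (\<phi> \<circ> null_coords))"

definition smooth_variation ::
  "(real \<times> real) set \<Rightarrow> (real \<times> real) set \<Rightarrow> real \<Rightarrow> (real \<times> real \<Rightarrow> G)
     \<Rightarrow> (real \<Rightarrow> real \<times> real \<Rightarrow> G) \<Rightarrow> bool" where
  "smooth_variation D K \<epsilon> \<phi> \<Phi> \<longleftrightarrow>
     smooth_on ({-\<epsilon><..<\<epsilon>} \<times> D) (\<lambda>(s, p). \<Phi> s p) \<and>
     (\<forall>p\<in>D. \<Phi> 0 p = \<phi> p) \<and>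
     (\<forall>s\<in>{-\<epsilon><..<\<epsilon>}. \<forall>p\<in>D - K. \<Phi> s p = \<phi> p)"

definition harmonic_map ::
  "real \<Rightarrow> real \<Rightarrow> (real \<times> real) set \<Rightarrow> (real \<times> real \<Rightarrow> G) \<Rightarrow> bool" where
  "harmonic_map \<mu>1 \<mu>2 D \<phi> \<longleftrightarrow>
     smooth_on D \<phi> \<and>
     (\<forall>K \<epsilon> \<Phi>. compact K \<and> K \<subseteq> D \<and> 0 < \<epsilon> \<and> smooth_variation D K \<epsilon> \<phi> \<Phi> \<longrightarrow>
        ((\<lambda>s. energy \<mu>1 \<mu>2 K (\<Phi> s)) has_real_derivative 0) (at 0))"


section \<open>The integral formula\<close>

text \<open>
  \<open>\<phi> = \<integral> (\<omega>0', e^(\<mu>1 x^0) \<omega>1', e^(\<mu>2 x^0) \<omega>2') + \<integral> (\<omega>0'', e^(\<mu>1 x^0) \<omega>1'', e^(\<mu>2 x^0) \<omega>2'')\<close>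
  on \<open>D\<close>, with base point \<open>p0\<close> and constants of integration \<open>\<phi> p0 = (c0, c1, c2)\<close>. Only the sum of
  the two line integrals is path independent, so the 1-forms \<open>\<omega>i' + \<omega>i''\<close> are integrated.
\<close>

definition given_by_formula ::
  "real \<Rightarrow> real \<Rightarrow> (real \<times> real) set \<Rightarrow> real \<times> real \<Rightarrow> G
     \<Rightarrow> one_form \<Rightarrow> one_form \<Rightarrow> one_form \<Rightarrow> one_form \<Rightarrow> one_form \<Rightarrow> one_form
     \<Rightarrow> (real \<times> real \<Rightarrow> G) \<Rightarrow> bool" where
  "given_by_formula \<mu>1 \<mu>2 D p0 c \<omega>0' \<omega>1' \<omega>2' \<omega>0'' \<omega>1'' \<omega>2'' \<phi> \<longleftrightarrow>
     (let x0 = (\<lambda>p. fst (\<phi> p)); x1 = (\<lambda>p. fst (snd (\<phi> p))); x2 = (\<lambda>p. snd (snd (\<phi> p))) in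
        is_integral_from D p0 (fst c) (\<lambda>p. \<omega>0' p + \<omega>0'' p) x0 \<and>
        is_integral_from D p0 (fst (snd c)) (\<lambda>p. exp (\<mu>1 * x0 p) *\<^sub>R (\<omega>1' p + \<omega>1'' p)) x1 \<and>
        is_integral_from D p0 (snd (snd c)) (\<lambda>p. exp (\<mu>2 * x0 p) *\<^sub>R (\<omega>2' p + \<omega>2'' p)) x2)"

end

theory Submission
  imports Defs "HOL-Complex_Analysis.Riemann_Mapping"
begin

text \<open>
  Write \<open>\<omega>i' = \<xi>i du\<close>, \<open>\<omega>i'' = \<eta>i dv\<close>. In coefficients the six hypotheses give the derivatives
  \<open>\<partial>\<^sub>v \<xi>i\<close> and \<open>\<partial>\<^sub>u \<eta>i\<close>. They are used in two combinations.

  The difference \<open>\<partial>\<^sub>v \<xi>0 - \<partial>\<^sub>u \<eta>0\<close> vanishes, so \<open>\<omega>0' + \<omega>0''\<close> is closed and has a primitive \<open>x0\<close>; once \<open>x0\<close> is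
  known, the equations for \<open>i = 1, 2\<close> say that \<open>exp (\<mu>i x0) (\<omega>i' + \<omega>i'')\<close> is closed as well, which gives
  \<open>x1\<close> and \<open>x2\<close>. Closed forms on a simply connected planar domain are exact (\<open>closed_form_exact\<close>): by the
  Riemann mapping theorem the domain is the plane or diffeomorphic to the unit disc, the pullback
  of a closed form is closed, and on a convex set a primitive is obtained by integrating along rays.
  A primitive integrates its differential along every path, and two maps given by the formula agree
  because the domain is path connected. This settles that the formula defines exactly one map.

  The sum \<open>\<partial>\<^sub>v \<xi>i + \<partial>\<^sub>u \<eta>i\<close> gives the harmonic map equation, expressed through the left-invariant
  components \<open>\<xi>i\<close>, \<open>\<eta>i\<close> of \<open>\<phi>\<^sub>u\<close>, \<open>\<phi>\<^sub>v\<close> (\<open>harmonic_map_of_null_frame\<close>). In null coordinates the energy density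
  is \<open>2 \<langle>\<phi>\<^sub>u, \<phi>\<^sub>v\<rangle>\<close>. For a variation \<open>\<Phi>\<^sub>s = \<phi> + V\<close> the density is expanded exactly in \<open>V\<close>, \<open>V\<^sub>u\<close>, \<open>V\<^sub>v\<close>. By the
  harmonic map equation the linear part is the divergence \<open>X\<^sub>u + Y\<^sub>v\<close> of a field that vanishes outside
  the compact set \<open>K\<close>, so its integral is zero (\<open>has_integral_null_divergence\<close>). The rest is at least
  quadratic in \<open>V\<close> and its derivatives, each of which is \<open>O(s)\<close> uniformly on \<open>K\<close>, so the energy differs from
  its value at \<open>s = 0\<close> by \<open>O(s\<^sup>2)\<close>, and its derivative there is \<open>0\<close>. Working with the finite difference \<open>V\<close>
  instead of \<open>\<partial>\<Phi>/\<partial>s\<close> avoids both differentiation under the integral sign and the exchange of \<open>\<partial>\<^sub>s\<close> with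
  \<open>\<partial>\<^sub>u\<close>, \<open>\<partial>\<^sub>v\<close>.
\<close>


section \<open>Calculus of maps of class \<open>C\<^sup>k\<close>\<close>

lemma frechet_derivative_cong_open:
  assumes "open S" "x \<in> S" "\<And>y. y \<in> S \<Longrightarrow> f y = g y"
  shows "frechet_derivative f (at x) = frechet_derivative g (at x)"
proof -
  have "(f has_derivative D) (at x) \<longleftrightarrow> (g has_derivative D) (at x)" for D
    using assms by (metis has_derivative_transform_within_open)
  then show ?thesis by (simp add: frechet_derivative_def)
qed

lemma Ck_on_cong:
  assumes "open S" "\<And>x. x \<in> S \<Longrightarrow> f x = g x"
  shows "Ck_on k S f \<longleftrightarrow> Ck_on k S g"
  using assms(2)
proof (induction k arbitrary: f g)
  case 0
  then show ?case by (simp cong: continuous_on_cong)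
next
  case (Suc k)
  have "f differentiable (at x) \<longleftrightarrow> g differentiable (at x)" if "x \<in> S" for x
    using that Suc.prems \<open>open S\<close> unfolding differentiable_def
    by (metis has_derivative_transform_within_open)
  moreover have "Ck_on k S (\<lambda>x. frechet_derivative f (at x) v)
      \<longleftrightarrow> Ck_on k S (\<lambda>x. frechet_derivative g (at x) v)" for v
    by (rule Suc.IH) (use frechet_derivative_cong_open[OF \<open>open S\<close>] Suc.prems in metis)
  ultimately show ?case by simp
qed

lemma Ck_on_SucI:
  assumes "open S" "\<And>x. x \<in> S \<Longrightarrow> (f has_derivative f' x) (at x)"
    and "\<And>v. Ck_on k S (\<lambda>x. f' x v)"
  shows "Ck_on (Suc k) S f"
proof -
  have "frechet_derivative f (at x) v = f' x v" if "x \<in> S" for x v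
    using frechet_derivative_at[OF assms(2)[OF that]] by simp
  then have "Ck_on k S (\<lambda>x. frechet_derivative f (at x) v) \<longleftrightarrow> Ck_on k S (\<lambda>x. f' x v)" for v
    by (intro Ck_on_cong[OF \<open>open S\<close>]) auto
  with assms(3) have "Ck_on k S (\<lambda>x. frechet_derivative f (at x) v)" for v
    by blast
  then show ?thesis using assms(2) by (auto simp: differentiable_def)
qed

lemma Ck_on_Suc_has_derivative:
  assumes "Ck_on (Suc k) S f" "x \<in> S"
  shows "(f has_derivative frechet_derivative f (at x)) (at x)"
  using assms by (simp add: frechet_derivative_works)

lemma Ck_on_Suc_imp: "Ck_on (Suc k) S f \<Longrightarrow> Ck_on k S f"
proof (induction k arbitrary: f)
  case 0
  have "continuous (at x) f" if "x \<in> S" for x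
    using 0 that by (simp add: differentiable_imp_continuous_within)
  then show ?case by (simp add: continuous_at_imp_continuous_on)
next
  case (Suc k)
  have "Ck_on k S (\<lambda>x. frechet_derivative f (at x) v)" for v
    by (rule Suc.IH) (use Suc.prems in simp)
  with Suc.prems show ?case by (simp only: Ck_on.simps(2)) blast
qed

lemma Ck_on_imp_continuous_on: "Ck_on k S f \<Longrightarrow> continuous_on S f"
proof (induction k)
  case (Suc k)
  show ?case by (rule Suc.IH[OF Ck_on_Suc_imp[OF Suc.prems]])
qed simp

lemma Ck_on_Suc_continuous:
  "Ck_on (Suc k) S f \<Longrightarrow> continuous_on S (\<lambda>x. frechet_derivative f (at x) v)"
  by (rule Ck_on_imp_continuous_on[of k]) simp

lemma Ck_on_1_has_derivative:
  "Ck_on 1 S f \<Longrightarrow> p \<in> S \<Longrightarrow> (f has_derivative frechet_derivative f (at p)) (at p)"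
  using Ck_on_Suc_has_derivative[of 0] by (simp del: Ck_on.simps)

lemma Ck_on_1_differentiable: "Ck_on 1 S f \<Longrightarrow> p \<in> S \<Longrightarrow> f differentiable (at p)"
  using Ck_on_1_has_derivative differentiable_def by blast

lemma Ck_on_const: "Ck_on k S (\<lambda>x. c)"
  by (induction k arbitrary: c) simp_all

lemma Ck_on_add:
  assumes "open S" "Ck_on k S f" "Ck_on k S g"
  shows "Ck_on k S (\<lambda>x. f x + g x)"
  using assms(2,3)
proof (induction k arbitrary: f g)
  case (Suc k)
  show ?case
  proof (rule Ck_on_SucI[OF \<open>open S\<close>])
    show "((\<lambda>x. f x + g x) has_derivative
        (\<lambda>v. frechet_derivative f (at x) v + frechet_derivative g (at x) v)) (at x)" if "x \<in> S" for x
      by (rule has_derivative_add[OF Suc.prems[THEN Ck_on_Suc_has_derivative[OF _ that]]])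
    show "Ck_on k S (\<lambda>x. frechet_derivative f (at x) v + frechet_derivative g (at x) v)" for v
      by (rule Suc.IH) (use Suc.prems in simp_all)
  qed
qed (simp add: continuous_on_add)

lemma Ck_on_mult:
  fixes f g :: "'a::real_normed_vector \<Rightarrow> real"
  assumes "open S" "Ck_on k S f" "Ck_on k S g"
  shows "Ck_on k S (\<lambda>x. f x * g x)"
  using assms(2,3)
proof (induction k arbitrary: f g)
  case (Suc k)
  show ?case
  proof (rule Ck_on_SucI[OF \<open>open S\<close>])
    show "((\<lambda>x. f x * g x) has_derivative
        (\<lambda>v. f x * frechet_derivative g (at x) v + frechet_derivative f (at x) v * g x)) (at x)"
      if "x \<in> S" for x
      by (rule has_derivative_mult[OF Suc.prems[THEN Ck_on_Suc_has_derivative[OF _ that]]])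
    show "Ck_on k S (\<lambda>x. f x * frechet_derivative g (at x) v + frechet_derivative f (at x) v * g x)" for v
      by (intro Ck_on_add[OF \<open>open S\<close>] Suc.IH Suc.prems[THEN Ck_on_Suc_imp])
        (use Suc.prems in simp_all)
  qed
qed (simp add: continuous_on_mult)

lemma Ck_on_diff:
  fixes f g :: "'a::real_normed_vector \<Rightarrow> real"
  assumes "open S" "Ck_on k S f" "Ck_on k S g"
  shows "Ck_on k S (\<lambda>x. f x - g x)"
  using Ck_on_add[OF assms(1,2) Ck_on_mult[OF assms(1) Ck_on_const[of k S "-1"] assms(3)]] by simp

lemma Ck_on_exp:
  fixes f :: "'a::real_normed_vector \<Rightarrow> real"
  assumes "open S" "Ck_on k S f"
  shows "Ck_on k S (\<lambda>x. exp (f x))"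
  using assms(2)
proof (induction k)
  case (Suc k)
  show ?case
  proof (rule Ck_on_SucI[OF \<open>open S\<close>])
    show "((\<lambda>x. exp (f x)) has_derivative
        (\<lambda>v. exp (f x) * frechet_derivative f (at x) v)) (at x)" if "x \<in> S" for x
      by (rule has_derivative_eq_rhs[OF has_derivative_exp[OF Ck_on_Suc_has_derivative[OF Suc.prems that]]])
        (simp add: mult.commute)
    show "Ck_on k S (\<lambda>x. exp (f x) * frechet_derivative f (at x) v)" for v
      by (intro Ck_on_mult[OF \<open>open S\<close>] Suc.IH Ck_on_Suc_imp[OF Suc.prems])
        (use Suc.prems in simp)
  qed
qed (simp add: continuous_on_exp)

lemma Ck_on_Pair:
  assumes "open S" "Ck_on k S f" "Ck_on k S g"
  shows "Ck_on k S (\<lambda>x. (f x, g x))"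
  using assms(2,3)
proof (induction k arbitrary: f g)
  case (Suc k)
  show ?case
  proof (rule Ck_on_SucI[OF \<open>open S\<close>])
    show "((\<lambda>x. (f x, g x)) has_derivative
        (\<lambda>v. (frechet_derivative f (at x) v, frechet_derivative g (at x) v))) (at x)" if "x \<in> S" for x
      by (rule has_derivative_Pair[OF Suc.prems[THEN Ck_on_Suc_has_derivative[OF _ that]]])
    show "Ck_on k S (\<lambda>x. (frechet_derivative f (at x) v, frechet_derivative g (at x) v))" for v
      by (rule Suc.IH) (use Suc.prems in simp_all)
  qed
qed (simp add: continuous_on_Pair)

lemma Ck_on_bounded_linear:
  assumes "open S" "bounded_linear L" "Ck_on k S f"
  shows "Ck_on k S (\<lambda>x. L (f x))"
  using assms(3)
proof (induction k arbitrary: f)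
  case 0
  then show ?case using bounded_linear.continuous_on[OF assms(2)] by simp
next
  case (Suc k)
  show ?case
  proof (rule Ck_on_SucI[OF \<open>open S\<close>])
    show "((\<lambda>x. L (f x)) has_derivative (\<lambda>v. L (frechet_derivative f (at x) v))) (at x)" if "x \<in> S" for x
      by (rule bounded_linear.has_derivative[OF assms(2) Ck_on_Suc_has_derivative[OF Suc.prems that]])
    show "Ck_on k S (\<lambda>x. L (frechet_derivative f (at x) v))" for v
      by (rule Suc.IH) (use Suc.prems in simp)
  qed
qed

text \<open>
  Freezes the parameter of a variation.
\<close>

lemma Ck_on_slice:
  assumes "open D" "s \<in> I" "Ck_on k (I \<times> D) f"
  shows "Ck_on k D (\<lambda>p. f (s, p))"
  using assms(3)
proof (induction k arbitrary: f)
  case 0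
  then show ?case using \<open>s \<in> I\<close> 
    by (auto intro!: continuous_on_compose2[of "I \<times> D" f] continuous_intros)
next
  case (Suc k)
  show ?case
  proof (rule Ck_on_SucI[OF \<open>open D\<close>])
    fix p assume p: "p \<in> D"
    have "(f has_derivative frechet_derivative f (at (s, p))) (at (s, p))"
      using Ck_on_Suc_has_derivative[OF Suc.prems] p \<open>s \<in> I\<close> by simp
    from has_derivative_compose[OF has_derivative_Pair[OF has_derivative_const has_derivative_ident] this]
    show "((\<lambda>p. f (s, p)) has_derivative (\<lambda>h. frechet_derivative f (at (s, p)) (0, h))) (at p)"
      by simp
  next
    show "Ck_on k D (\<lambda>p. frechet_derivative f (at (s, p)) (0, h))" for h
      by (rule Suc.IH) (use Suc.prems in simp)
  qed
qed

text \<open>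
  A primitive is one order smoother than the coefficients of its differential. This is what makes
  the map given by the integral formula smooth.
\<close>

lemma Ck_on_gradient:
  fixes a b :: "real \<times> real \<Rightarrow> real"
  assumes "open S" "Ck_on k S a" "Ck_on k S b"
    and F: "\<And>p. p \<in> S \<Longrightarrow> (F has_derivative (\<lambda>h. a p * fst h + b p * snd h)) (at p)"
  shows "Ck_on (Suc k) S F"
proof (rule Ck_on_SucI[OF \<open>open S\<close>])
  show "(F has_derivative (\<lambda>h. a p * fst h + b p * snd h)) (at p)" if "p \<in> S" for p by (rule F[OF that])
  show "Ck_on k S (\<lambda>p. a p * fst h + b p * snd h)" for h
    by (intro Ck_on_add[OF \<open>open S\<close>] Ck_on_mult[OF \<open>open S\<close>] Ck_on_const assms(2,3))
qed

lemma smooth_on_gradient: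
  fixes a b :: "real \<times> real \<Rightarrow> real"
  assumes "open D" "smooth_on D a" "smooth_on D b"
    and "\<And>p. p \<in> D \<Longrightarrow> (F has_derivative (\<lambda>h. a p * fst h + b p * snd h)) (at p)"
  shows "smooth_on D F"
  using Ck_on_Suc_imp[OF Ck_on_gradient[OF \<open>open D\<close> _ _ assms(4)]] assms(2,3)
  unfolding smooth_on_def by blast

lemma smooth_on_exp_mult:
  fixes x w :: "'a::real_normed_vector \<Rightarrow> real"
  assumes "open D" "smooth_on D x" "smooth_on D w"
  shows "smooth_on D (\<lambda>p. exp (\<mu> * x p) * w p)"
  using assms unfolding smooth_on_def
  by (intro allI Ck_on_mult[OF \<open>open D\<close>] Ck_on_exp[OF \<open>open D\<close>] Ck_on_const) blast+


section \<open>Partial derivatives in the plane\<close>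

lemma has_vector_derivative_slice1:
  assumes "(f has_derivative f') (at p)"
  shows "((\<lambda>s. f (s, snd p)) has_vector_derivative f' (1, 0)) (at (fst p))"
proof -
  interpret bounded_linear f' using assms by (rule has_derivative_bounded_linear)
  have "((\<lambda>s. f (s, snd p)) has_derivative (\<lambda>h. f' (h, 0))) (at (fst p))"
    by (rule has_derivative_compose[where f="\<lambda>s. (s, snd p)" and g=f])
      (use assms in \<open>auto intro: has_derivative_Pair has_derivative_ident has_derivative_const\<close>)
  moreover have "(\<lambda>h. f' (h, 0)) = (\<lambda>h. h *\<^sub>R f' (1, 0))"
    by (simp flip: scale)
  ultimately show ?thesis
    by (simp only: has_vector_derivative_def)
qed

lemma partial1_eq: "(f has_derivative f') (at p) \<Longrightarrow> partial1 f p = f' (1, 0)"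
  unfolding partial1_def by (intro vector_derivative_at has_vector_derivative_slice1)

lemma has_vector_derivative_slice2:
  assumes "(f has_derivative f') (at p)"
  shows "((\<lambda>s. f (fst p, s)) has_vector_derivative f' (0, 1)) (at (snd p))"
proof -
  interpret bounded_linear f' using assms by (rule has_derivative_bounded_linear)
  have "((\<lambda>s. f (fst p, s)) has_derivative (\<lambda>h. f' (0, h))) (at (snd p))"
    by (rule has_derivative_compose[where f="\<lambda>s. (fst p, s)" and g=f])
      (use assms in \<open>auto intro: has_derivative_Pair has_derivative_ident has_derivative_const\<close>)
  moreover have "(\<lambda>h. f' (0, h)) = (\<lambda>h. h *\<^sub>R f' (0, 1))"
    by (simp flip: scale)
  ultimately show ?thesis
    by (simp only: has_vector_derivative_def)
qed

lemma partial2_eq: "(f has_derivative f') (at p) \<Longrightarrow> partial2 f p = f' (0, 1)"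
  unfolding partial2_def by (intro vector_derivative_at has_vector_derivative_slice2)

lemma has_derivative_partials:
  fixes f :: "real \<times> real \<Rightarrow> real"
  assumes "(f has_derivative f') (at p)"
  shows "f' h = partial1 f p * fst h + partial2 f p * snd h"
proof -
  interpret bounded_linear f' using assms by (rule has_derivative_bounded_linear)
  have "f' h = f' (fst h *\<^sub>R (1, 0) + snd h *\<^sub>R (0, 1))" by simp
  then show ?thesis
    unfolding add scale by (simp add: partial1_eq[OF assms] partial2_eq[OF assms])
qed

lemma partial_add:
  fixes f g :: "real \<times> real \<Rightarrow> real"
  assumes "f differentiable (at p)" "g differentiable (at p)"
  shows "partial1 (\<lambda>p. f p + g p) p = partial1 f p + partial1 g p"
    and "partial2 (\<lambda>p. f p + g p) p = partial2 f p + partial2 g p"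
proof -
  obtain f' g' where d: "(f has_derivative f') (at p)" "(g has_derivative g') (at p)"
    using assms unfolding differentiable_def by blast
  note s = has_derivative_add[OF d]
  show "partial1 (\<lambda>p. f p + g p) p = partial1 f p + partial1 g p"
    "partial2 (\<lambda>p. f p + g p) p = partial2 f p + partial2 g p"
    unfolding partial1_eq[OF s] partial2_eq[OF s] by (simp_all add: partial1_eq[OF d(1)] partial1_eq[OF d(2)] partial2_eq[OF d(1)] partial2_eq[OF d(2)])
qed

lemma partial_exp_mult:
  fixes x w a b :: "real \<times> real \<Rightarrow> real"
  assumes x: "(x has_derivative (\<lambda>h. a p * fst h + b p * snd h)) (at p)"
    and "w differentiable (at p)"
  shows "partial1 (\<lambda>p. exp (\<mu> * x p) * w p) p = exp (\<mu> * x p) * (\<mu> * a p * w p + partial1 w p)"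
    and "partial2 (\<lambda>p. exp (\<mu> * x p) * w p) p = exp (\<mu> * x p) * (\<mu> * b p * w p + partial2 w p)"
proof -
  obtain w' where w: "(w has_derivative w') (at p)"
    using assms(2) unfolding differentiable_def by blast
  have d: "((\<lambda>p. exp (\<mu> * x p) * w p) has_derivative
      (\<lambda>h. exp (\<mu> * x p) * (\<mu> * (a p * fst h + b p * snd h) * w p + w' h))) (at p)"
    by (rule derivative_eq_intros x w refl)+ (simp add: algebra_simps)
  show "partial1 (\<lambda>p. exp (\<mu> * x p) * w p) p = exp (\<mu> * x p) * (\<mu> * a p * w p + partial1 w p)"
    "partial2 (\<lambda>p. exp (\<mu> * x p) * w p) p = exp (\<mu> * x p) * (\<mu> * b p * w p + partial2 w p)"
    unfolding partial1_eq[OF d] partial2_eq[OF d] by (simp_all add: partial1_eq[OF w] partial2_eq[OF w])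
qed

text \<open>
  With \<open>\<mu> = \<mu>i\<close>, \<open>i = 1, 2\<close>, and \<open>v\<close> the corresponding component of a variation, the bracket multiplying \<open>v\<close>
  is the \<open>i\<close>-th component of the harmonic map equation; when it vanishes, only the derivatives of \<open>v\<close>
  survive. For \<open>\<mu> = 0\<close> the bracket is the divergence in the equation for the time component.
\<close>

lemma divergence_exp_weighted:
  fixes x v \<eta> \<xi> a b :: "real \<times> real \<Rightarrow> real"
  assumes x: "(x has_derivative (\<lambda>h. a p * fst h + b p * snd h)) (at p)"
    and "v differentiable (at p)" "\<eta> differentiable (at p)" "\<xi> differentiable (at p)"
  shows "partial1 (\<lambda>p. c * exp (- \<mu> * x p) * v p * \<eta> p) p + partial2 (\<lambda>p. c * exp (- \<mu> * x p) * v p * \<xi> p) p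
    = c * exp (- \<mu> * x p) * (partial1 v p * \<eta> p + partial2 v p * \<xi> p
        + v p * (partial1 \<eta> p + partial2 \<xi> p - \<mu> * (a p * \<eta> p + b p * \<xi> p)))"
proof -
  obtain v' \<eta>' \<xi>' where d: "(v has_derivative v') (at p)" "(\<eta> has_derivative \<eta>') (at p)"
    "(\<xi> has_derivative \<xi>') (at p)"
    using assms(2-4) unfolding differentiable_def by blast
  have w: "((\<lambda>p. c * exp (- \<mu> * x p) * v p * w p) has_derivative
      (\<lambda>h. c * exp (- \<mu> * x p) * (v' h * w p + v p * w' h - \<mu> * (a p * fst h + b p * snd h) * v p * w p))) (at p)"
    if "(w has_derivative w') (at p)" for w w'
    by (rule derivative_eq_intros x d(1) that refl)+ (simp add: algebra_simps)
  show ?thesis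
    unfolding partial1_eq[OF w[OF d(2)]] partial2_eq[OF w[OF d(3)]]
    by (simp add: partial1_eq[OF d(1)] partial1_eq[OF d(2)] partial2_eq[OF d(1)] partial2_eq[OF d(3)] algebra_simps)
qed


section \<open>Closed 1-forms on simply connected planar domains\<close>

text \<open>
  The potential is \<open>F x = \<integral>\<^sub>0\<^sup>1 V (t x) \<bullet> x dt\<close>. Differentiating under the integral sign and using the symmetry
  of \<open>DV\<close>, its gradient at \<open>x\<close> is \<open>\<integral>\<^sub>0\<^sup>1 (t DV (t x) x + V (t x)) dt\<close>, and the integrand is the derivative of
  \<open>t V (t x)\<close> with respect to \<open>t\<close>.
\<close>

lemma gradient_of_symmetric_field_convex:
  fixes V :: "'a::euclidean_space \<Rightarrow> 'a"
  assumes "open U" "convex U" "0 \<in> U"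
    and V: "\<And>x. x \<in> U \<Longrightarrow> (V has_derivative DV x) (at x)"
    and cont: "\<And>h. continuous_on U (\<lambda>x. DV x h)"
    and sym: "\<And>x a b. x \<in> U \<Longrightarrow> DV x a \<bullet> b = DV x b \<bullet> a"
  shows "\<exists>F. \<forall>x\<in>U. (F has_derivative (\<lambda>h. V x \<bullet> h)) (at x)"
proof -
  \<comment> \<open>\<open>w x t\<close> is the derivative of \<open>t V (t x)\<close> in \<open>t\<close> and, by symmetry, the gradient of \<open>V (t x) \<bullet> x\<close> in \<open>x\<close>.\<close>
  define w where "w x t = t *\<^sub>R DV (t *\<^sub>R x) x + V (t *\<^sub>R x)" for x and t :: real
  define F where "F x = integral (cbox 0 1) (\<lambda>t. V (t *\<^sub>R x) \<bullet> x)" for x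
  have ray: "t *\<^sub>R x \<in> U" if "x \<in> U" "t \<in> cbox 0 1" for x t
    using convexD_alt[OF \<open>convex U\<close> \<open>0 \<in> U\<close> \<open>x \<in> U\<close>, of t] that by simp
  have contV: "continuous_on U V"
    using V by (meson continuous_at_imp_continuous_on has_derivative_continuous)
  \<comment> \<open>Reduces joint continuity of \<open>DV (t x) x\<close> to continuity of \<open>DV\<close> in a fixed direction.\<close>
  have DV_Basis: "DV x h = (\<Sum>b\<in>Basis. (h \<bullet> b) *\<^sub>R DV x b)" if "x \<in> U" for x h
  proof -
    interpret bounded_linear "DV x" using V[OF that] by (rule has_derivative_bounded_linear)
    have "DV x h = DV x (\<Sum>b\<in>Basis. (h \<bullet> b) *\<^sub>R b)" by (simp add: euclidean_representation)
    then show ?thesis by (simp only: sum scale)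
  qed
  have cont_ray: "continuous_on (U \<times> cbox 0 1) (\<lambda>q. snd q *\<^sub>R fst q)"
    by (intro continuous_intros)
  have ray': "(\<lambda>q. snd q *\<^sub>R fst q) ` (U \<times> cbox 0 1) \<subseteq> U" using ray by auto
  have cont_w: "continuous_on (U \<times> cbox 0 1) (\<lambda>(x, t). w x t)"
  proof -
    have "continuous_on (U \<times> cbox 0 1) (\<lambda>q. snd q *\<^sub>R
        (\<Sum>b\<in>Basis. (fst q \<bullet> b) *\<^sub>R DV (snd q *\<^sub>R fst q) b) + V (snd q *\<^sub>R fst q))"
      by (intro continuous_intros continuous_on_compose2[OF cont cont_ray ray']
          continuous_on_compose2[OF contV cont_ray ray'])
    then show ?thesis
      by (rule continuous_on_eq) (auto simp: w_def DV_Basis[OF ray])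
  qed
  have int_w: "(w x has_integral V x) (cbox 0 1)" if "x \<in> U" for x
  proof -
    have "((\<lambda>t. t *\<^sub>R V (t *\<^sub>R x)) has_vector_derivative w x t) (at t within {0..1})"
      if t: "t \<in> {0..1}" for t
    proof -
      have tx: "t *\<^sub>R x \<in> U" using ray \<open>x \<in> U\<close> t by simp
      interpret bounded_linear "DV (t *\<^sub>R x)" using V[OF tx] by (rule has_derivative_bounded_linear)
      have "((\<lambda>t. V (t *\<^sub>R x)) has_derivative (\<lambda>h. DV (t *\<^sub>R x) (h *\<^sub>R x))) (at t within {0..1})"
        by (rule has_derivative_compose[where f="\<lambda>t. t *\<^sub>R x", OF _ V[OF tx]]) (auto intro!: derivative_eq_intros)
      then have "((\<lambda>t. t *\<^sub>R V (t *\<^sub>R x)) has_derivative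
          (\<lambda>h. t *\<^sub>R DV (t *\<^sub>R x) (h *\<^sub>R x) + h *\<^sub>R V (t *\<^sub>R x))) (at t within {0..1})"
        by (intro has_derivative_scaleR has_derivative_ident)
      then show ?thesis
        unfolding has_vector_derivative_def w_def by (simp add: scale algebra_simps)
    qed
    from fundamental_theorem_of_calculus[OF _ this] show ?thesis by simp
  qed
  have "(F has_derivative (\<lambda>h. V x \<bullet> h)) (at x)" if x: "x \<in> U" for x
  proof -
    have "((\<lambda>x. integral (cbox 0 1) (\<lambda>t. V (t *\<^sub>R x) \<bullet> x)) has_derivative
        blinfun_apply (integral (cbox 0 1) (\<lambda>t. blinfun_inner_right (w x t)))) (at x within U)"
    proof (rule leibniz_rule[OF _ _ _ x \<open>convex U\<close>])
      fix y t assume y: "y \<in> U" and t: "t \<in> cbox (0::real) 1"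
      have ty: "t *\<^sub>R y \<in> U" using ray y t by simp
      interpret bounded_linear "DV (t *\<^sub>R y)" using V[OF ty] by (rule has_derivative_bounded_linear)
      have "((\<lambda>y. V (t *\<^sub>R y)) has_derivative (\<lambda>h. DV (t *\<^sub>R y) (t *\<^sub>R h))) (at y within U)"
        by (rule has_derivative_compose[where f="\<lambda>y. t *\<^sub>R y", OF _ V[OF ty]]) (auto intro!: derivative_eq_intros)
      then have "((\<lambda>y. V (t *\<^sub>R y) \<bullet> y) has_derivative
          (\<lambda>h. V (t *\<^sub>R y) \<bullet> h + DV (t *\<^sub>R y) (t *\<^sub>R h) \<bullet> y)) (at y within U)"
        by (intro has_derivative_inner has_derivative_ident)
      moreover have "V (t *\<^sub>R y) \<bullet> h + DV (t *\<^sub>R y) (t *\<^sub>R h) \<bullet> y = blinfun_inner_right (w y t) h" for h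
        by (simp add: w_def inner_add_left scale sym[OF ty, of h y])
      ultimately show "((\<lambda>y. V (t *\<^sub>R y) \<bullet> y) has_derivative blinfun_inner_right (w y t)) (at y within U)"
        by simp
    next
      fix y assume y: "y \<in> U"
      show "(\<lambda>t. V (t *\<^sub>R y) \<bullet> y) integrable_on cbox 0 1"
        by (intro integrable_continuous continuous_intros continuous_on_compose2[OF contV])
          (use ray y in auto)
    next
      show "continuous_on (U \<times> cbox 0 1) (\<lambda>(x, t). blinfun_inner_right (w x t))"
        using bounded_linear.continuous_on[OF bounded_linear_blinfun_inner_right cont_w]
        by (simp add: case_prod_unfold)
    qed
    moreover have "((\<lambda>t. blinfun_inner_right (w x t)) has_integral blinfun_inner_right (V x)) (cbox 0 1)"
      using has_integral_linear[OF int_w[OF x] bounded_linear_blinfun_inner_right] by (simp add: o_def)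
    then have "integral (cbox 0 1) (\<lambda>t. blinfun_inner_right (w x t)) = blinfun_inner_right (V x)"
      by (rule integral_unique)
    ultimately show ?thesis
      unfolding F_def[abs_def] at_within_open[OF x \<open>open U\<close>] by simp
  qed
  then show ?thesis by blast
qed

text \<open>
  The transpose of multiplication by \<open>a\<close> is multiplication by \<open>cnj a\<close>; hence the covector field \<open>V\<close>, written
  as a vector field, pulls back along a holomorphic \<open>g\<close> to \<open>cnj g' * (V \<circ> g)\<close>.
\<close>

lemma complex_inner_mult_left: "(cnj a * v) \<bullet> h = v \<bullet> (a * h)" for a v h :: complex
  by (simp add: inner_complex_def algebra_simps)

text \<open>
  A Riemann map transports the problem to the unit disc. The derivative of the pulled back field stays
  symmetric: \<open>g''\<close> enters it through \<open>cnj (g'' h) * V\<close>, whose inner product with \<open>k\<close> is symmetric in \<open>h\<close> and \<open>k\<close>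
  because complex multiplication is commutative.
\<close>

lemma gradient_of_symmetric_field_complex:
  fixes V :: "complex \<Rightarrow> complex"
  assumes "open S" "simply_connected S"
    and V: "\<And>x. x \<in> S \<Longrightarrow> (V has_derivative DV x) (at x)"
    and cont: "\<And>h. continuous_on S (\<lambda>x. DV x h)"
    and sym: "\<And>x a b. x \<in> S \<Longrightarrow> DV x a \<bullet> b = DV x b \<bullet> a"
  shows "\<exists>F. \<forall>x\<in>S. (F has_derivative (\<lambda>h. V x \<bullet> h)) (at x)"
proof -
  consider "S = {}" | "S = UNIV"
    | f g where "f holomorphic_on S" "g holomorphic_on ball 0 1"
      "\<And>z. z \<in> S \<Longrightarrow> f z \<in> ball 0 1 \<and> g (f z) = z" "\<And>z. z \<in> ball 0 1 \<Longrightarrow> g z \<in> S"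
    using assms(1,2) simply_connected_eq_biholomorphic_to_disc[of S] by metis
  then show ?thesis
  proof cases
    case 2
    show ?thesis
      by (rule gradient_of_symmetric_field_convex[OF _ _ _ V cont sym]) (simp_all add: 2)
  next
    case f: (3 f g)
    define B where "B = ball (0::complex) 1"
    define g' where "g' = deriv g"
    \<comment> \<open>The pullback of \<open>V\<close> along \<open>g\<close>.\<close>
    define W where "W z = cnj (g' z) * V (g z)" for z
    define DW where "DW z h = cnj (g' z) * DV (g z) (g' z * h) + cnj (deriv g' z * h) * V (g z)" for z h
    have B: "open B" "convex B" "0 \<in> B" and gB: "g holomorphic_on B" "\<And>z. z \<in> B \<Longrightarrow> g z \<in> S"
      using f by (auto simp: B_def)
    have g'B: "g' holomorphic_on B"
      unfolding g'_def using gB B by (intro holomorphic_deriv)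
    have dg: "(g has_field_derivative g' z) (at z)" if "z \<in> B" for z
      unfolding g'_def using holomorphic_derivI[OF gB(1) B(1) that] by simp
    have dg': "(g' has_field_derivative deriv g' z) (at z)" if "z \<in> B" for z
      using holomorphic_derivI[OF g'B(1) B(1) that] by simp
    have lin: "bounded_linear (DV (g z))" if "z \<in> B" for z
      using V gB(2) that has_derivative_bounded_linear by blast
    have "\<exists>G. \<forall>z\<in>B. (G has_derivative (\<lambda>h. W z \<bullet> h)) (at z)"
    proof (rule gradient_of_symmetric_field_convex[OF B, where DV=DW])
      fix z assume z: "z \<in> B"
      have "((\<lambda>z. V (g z)) has_derivative (\<lambda>h. DV (g z) (g' z * h))) (at z)"
        using has_derivative_compose[OF has_field_derivative_imp_has_derivative[OF dg[OF z]] V[OF gB(2)[OF z]]]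
        by simp
      moreover have "((\<lambda>z. cnj (g' z)) has_derivative (\<lambda>h. cnj (deriv g' z * h))) (at z)"
        using bounded_linear.has_derivative[OF bounded_linear_cnj
            has_field_derivative_imp_has_derivative[OF dg'[OF z]]] by simp
      ultimately show "(W has_derivative DW z) (at z)"
        unfolding W_def[abs_def] DW_def[abs_def] by (intro has_derivative_mult)
      show "DW z a \<bullet> b = DW z b \<bullet> a" for a b
        unfolding DW_def inner_add_left complex_inner_mult_left
        using sym[OF gB(2)[OF z], of "g' z * a" "g' z * b"]
        by (simp add: complex_inner_mult_left mult.left_commute mult.commute)
    next
      fix h
      have c: "continuous_on B g" "continuous_on B g'" "continuous_on B (deriv g')"
        using gB(1) g'B holomorphic_deriv[OF g'B B(1)] by (auto intro: holomorphic_on_imp_continuous_on)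
      have im: "g ` B \<subseteq> S" using gB(2) by blast
      have contV: "continuous_on S V"
        using V by (meson continuous_at_imp_continuous_on has_derivative_continuous)
      have "DV (g z) (g' z * h) = Re (g' z * h) *\<^sub>R DV (g z) 1 + Im (g' z * h) *\<^sub>R DV (g z) \<i>" if "z \<in> B" for z
      proof -
        interpret bounded_linear "DV (g z)" by (rule lin[OF that])
        have "g' z * h = Re (g' z * h) *\<^sub>R 1 + Im (g' z * h) *\<^sub>R \<i>"
          by (simp add: complex_eq_iff)
        then show ?thesis by (metis add scale)
      qed
      moreover have "continuous_on B (\<lambda>z. cnj (g' z) * (Re (g' z * h) *\<^sub>R DV (g z) 1 + Im (g' z * h) *\<^sub>R DV (g z) \<i>)
            + cnj (deriv g' z * h) * V (g z))"
        by (intro continuous_intros c continuous_on_compose2[OF cont c(1) im]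
            continuous_on_compose2[OF contV c(1) im])
      ultimately show "continuous_on B (\<lambda>z. DW z h)"
        unfolding DW_def by (simp cong: continuous_on_cong)
    qed
    then obtain G where G: "\<And>z. z \<in> B \<Longrightarrow> (G has_derivative (\<lambda>h. W z \<bullet> h)) (at z)" by blast
    \<comment> \<open>\<open>f\<close> inverts \<open>g\<close>, so pulling the potential back along \<open>f\<close> undoes the pullback along \<open>g\<close>.\<close>
    have "((\<lambda>z. G (f z)) has_derivative (\<lambda>h. V z \<bullet> h)) (at z)" if z: "z \<in> S" for z
    proof -
      have fz: "f z \<in> B" "g (f z) = z" using f(3)[OF z] by (auto simp: B_def)
      have df: "(f has_field_derivative deriv f z) (at z)"
        using holomorphic_derivI[OF f(1) assms(1) z] by simp
      have "((\<lambda>z. g (f z)) has_field_derivative g' (f z) * deriv f z) (at z)"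
        using DERIV_chain2[OF dg[OF fz(1)] df] by simp
      moreover have "((\<lambda>z. g (f z)) has_field_derivative 1) (at z)"
        by (rule has_field_derivative_transform_within_open[OF DERIV_ident assms(1) z]) (use f(3) in auto)
      ultimately have 1: "g' (f z) * deriv f z = 1" by (rule DERIV_unique)
      have "((\<lambda>z. G (f z)) has_derivative (\<lambda>h. W (f z) \<bullet> (deriv f z * h))) (at z)"
        using has_derivative_compose[OF has_field_derivative_imp_has_derivative[OF df] G[OF fz(1)]] by simp
      moreover have "W (f z) \<bullet> (deriv f z * h) = V z \<bullet> h" for h
        using 1 by (simp add: W_def complex_inner_mult_left fz mult.assoc[symmetric])
      ultimately show ?thesis by simp
    qed
    then show ?thesis by blast
  qed simp
qed

lemma gradient_of_symmetric_field_plane: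
  fixes V :: "real \<times> real \<Rightarrow> real \<times> real"
  assumes "open S" "simply_connected S"
    and V: "\<And>x. x \<in> S \<Longrightarrow> (V has_derivative DV x) (at x)"
    and cont: "\<And>h. continuous_on S (\<lambda>x. DV x h)"
    and sym: "\<And>x a b. x \<in> S \<Longrightarrow> DV x a \<bullet> b = DV x b \<bullet> a"
  shows "\<exists>F. \<forall>x\<in>S. (F has_derivative (\<lambda>h. V x \<bullet> h)) (at x)"
proof -
  define c where "c p = Complex (fst p) (snd p)" for p
  define r where "r z = (Re z, Im z)" for z
  have c_alt: "c = (\<lambda>p. of_real (fst p) + \<i> * of_real (snd p))"
    by (auto simp: c_def fun_eq_iff complex_eq_iff)
  have lc: "bounded_linear c"
    unfolding c_alt by (intro bounded_linear_intros bounded_linear_add bounded_linear_const_mult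
       bounded_linear_compose[OF bounded_linear_of_real] bounded_linear_fst bounded_linear_snd)
  have lr: "bounded_linear r"
    unfolding r_def[abs_def] by (intro bounded_linear_Pair bounded_linear_Re bounded_linear_Im)
  have [simp]: "r (c p) = p" "c (r z) = z" for p z by (simp_all add: c_def r_def)
  have inner: "c p \<bullet> z = p \<bullet> r z" for p z
    by (simp add: c_def r_def inner_complex_def inner_prod_def)
  have contr: "continuous_on A r" and contc: "continuous_on A' c" for A A'
    using lr lc by (auto intro: linear_continuous_on)
  have cS: "z \<in> c ` S \<longleftrightarrow> r z \<in> S" for z by (metis \<open>\<And>z. c (r z) = z\<close> \<open>\<And>p. r (c p) = p\<close> image_iff)
  have "S homeomorphic c ` S"
    unfolding homeomorphic_def homeomorphism_def
    by (intro exI[of _ c] exI[of _ r]) (auto simp: contr contc cS image_iff)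
  then have "simply_connected (c ` S)"
    using assms(2) homeomorphic_simply_connected by blast
  moreover have "open (c ` S)"
  proof -
    have "c ` S = r -` S" using cS by blast
    then show ?thesis
      using open_vimage[OF assms(1)] contr by metis
  qed
  moreover have dV: "((\<lambda>z. c (V (r z))) has_derivative (\<lambda>h. c (DV (r z) (r h)))) (at z)" if "z \<in> c ` S" for z
  proof -
    have "((\<lambda>z. V (r z)) has_derivative (\<lambda>h. DV (r z) (r h))) (at z)"
      by (rule has_derivative_compose[OF bounded_linear_imp_has_derivative[OF lr] V]) (use that cS in auto)
    then show ?thesis by (rule bounded_linear.has_derivative[OF lc])
  qed
  moreover have "continuous_on (c ` S) (\<lambda>z. c (DV (r z) (r h)))" for h
    by (intro continuous_on_compose2[OF contc[of UNIV]] continuous_on_compose2[OF cont contr]) (auto simp: cS)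
  moreover have "c (DV (r z) (r a)) \<bullet> b = c (DV (r z) (r b)) \<bullet> a" if "z \<in> c ` S" for z a b
    using that sym cS by (simp add: inner)
  ultimately obtain F where F: "\<And>z. z \<in> c ` S \<Longrightarrow> (F has_derivative (\<lambda>h. c (V (r z)) \<bullet> h)) (at z)"
    using gradient_of_symmetric_field_complex[of "c ` S" "\<lambda>z. c (V (r z))" "\<lambda>z h. c (DV (r z) (r h))"] by metis
  have "((\<lambda>p. F (c p)) has_derivative (\<lambda>h. V p \<bullet> h)) (at p)" if "p \<in> S" for p
    using has_derivative_compose[OF bounded_linear_imp_has_derivative[OF lc, of "at p"] F[of "c p"]] that
    by (simp add: inner)
  then show ?thesis by blast
qed

text \<open>
  The Poincare lemma for \<open>a du + b dv\<close>; closedness is the symmetry of the derivative of \<open>(a, b)\<close>.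
\<close>

lemma closed_form_exact:
  fixes a b :: "real \<times> real \<Rightarrow> real"
  assumes "open D" "simply_connected D" and a: "Ck_on 1 D a" and b: "Ck_on 1 D b"
    and closed: "\<And>p. p \<in> D \<Longrightarrow> partial2 a p = partial1 b p"
  shows "\<exists>F. F p0 = c \<and> (\<forall>p\<in>D. (F has_derivative (\<lambda>h. a p * fst h + b p * snd h)) (at p))"
proof -
  define DV where "DV p h = (frechet_derivative a (at p) h, frechet_derivative b (at p) h)" for p h
  note d = a[unfolded One_nat_def, THEN Ck_on_Suc_has_derivative] b[unfolded One_nat_def, THEN Ck_on_Suc_has_derivative]
  have "\<exists>F. \<forall>p\<in>D. (F has_derivative (\<lambda>h. (a p, b p) \<bullet> h)) (at p)"
  proof (rule gradient_of_symmetric_field_plane[OF assms(1,2), where DV=DV])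
    fix p assume p: "p \<in> D"
    show "((\<lambda>p. (a p, b p)) has_derivative DV p) (at p)"
      unfolding DV_def[abs_def] by (intro has_derivative_Pair d p)
    show "DV p h \<bullet> k = DV p k \<bullet> h" for h k
      unfolding DV_def inner_prod_def
      by (simp add: has_derivative_partials[OF d(1)[OF p]] has_derivative_partials[OF d(2)[OF p]]
          closed[OF p] algebra_simps)
  next
    show "continuous_on D (\<lambda>p. DV p h)" for h
      unfolding DV_def by (intro continuous_on_Pair a[unfolded One_nat_def, THEN Ck_on_Suc_continuous] b[unfolded One_nat_def, THEN Ck_on_Suc_continuous])
  qed
  then obtain F where F: "\<And>p. p \<in> D \<Longrightarrow> (F has_derivative (\<lambda>h. a p * fst h + b p * snd h)) (at p)"
    by (auto simp: inner_prod_def)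
  show ?thesis
  proof (intro exI[of _ "\<lambda>p. F p + (c - F p0)"] conjI ballI)
    show "((\<lambda>p. F p + (c - F p0)) has_derivative (\<lambda>h. a p * fst h + b p * snd h)) (at p)" if "p \<in> D" for p
      using has_derivative_add[OF F[OF that] has_derivative_const[of "c - F p0"]] by simp
  qed simp
qed


section \<open>Line integrals and primitives\<close>

text \<open>
  The fundamental theorem of calculus along \<open>\<gamma>\<close>, which is differentiable outside a finite set.
\<close>

lemma is_integral_from_gradient:
  assumes F: "\<And>p. p \<in> D \<Longrightarrow> (F has_derivative (\<lambda>h. \<alpha> p \<bullet> h)) (at p)"
  shows "is_integral_from D p0 (F p0) \<alpha> F"
  unfolding is_integral_from_def has_line_integral_def
proof (intro allI impI, elim conjE)
  fix \<gamma> :: "real \<Rightarrow> real \<times> real"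
  assume \<gamma>: "valid_path \<gamma>" "path_image \<gamma> \<subseteq> D" "pathstart \<gamma> = p0"
  obtain S where S: "finite S" "\<gamma> C1_differentiable_on {0..1} - S" and cont: "continuous_on {0..1} \<gamma>"
    using \<gamma>(1) unfolding valid_path_def piecewise_C1_differentiable_on_def by auto
  have D: "\<gamma> t \<in> D" if "t \<in> {0..1}" for t using \<gamma>(2) that by (auto simp: path_image_def)
  have contF: "continuous_on D F"
    using F by (meson continuous_at_imp_continuous_on has_derivative_continuous)
  have "((\<lambda>s. \<alpha> (\<gamma> s) \<bullet> vector_derivative \<gamma> (at s within {0..1})) has_integral
      ((\<lambda>t. F (\<gamma> t)) 1 - (\<lambda>t. F (\<gamma> t)) 0)) {0..1}"
  proof (rule fundamental_theorem_of_calculus_strong[OF S(1)])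
    fix t assume t: "t \<in> {0..1} - S"
    then obtain v where v: "(\<gamma> has_vector_derivative v) (at t)"
      using S(2) unfolding C1_differentiable_on_def by blast
    then have "vector_derivative \<gamma> (at t within {0..1}) = v"
      using t by (intro vector_derivative_at_within_ivl) auto
    moreover have "((\<lambda>t. F (\<gamma> t)) has_derivative (\<lambda>h. \<alpha> (\<gamma> t) \<bullet> (h *\<^sub>R v))) (at t)"
      using has_derivative_compose[OF v[unfolded has_vector_derivative_def] F[OF D]] t by simp
    ultimately show "((\<lambda>t. F (\<gamma> t)) has_vector_derivative
        \<alpha> (\<gamma> t) \<bullet> vector_derivative \<gamma> (at t within {0..1})) (at t)"
      by (simp add: has_vector_derivative_def)
  next
    show "continuous_on {0..1} (\<lambda>t. F (\<gamma> t))"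
      by (rule continuous_on_compose2[OF contF cont]) (use D in auto)
  qed simp
  then show "((\<lambda>s. \<alpha> (\<gamma> s) \<bullet> vector_derivative \<gamma> (at s within {0..1})) has_integral
      F (pathfinish \<gamma>) - F p0) {0..1}"
    using \<gamma>(3) by (auto simp: pathfinish_def pathstart_def)
qed

text \<open>
  Any point of \<open>D\<close> is the end of some path on which both line integrals are defined, and they coincide
  there.
\<close>

lemma is_integral_from_unique:
  assumes "open D" "connected D" "p0 \<in> D" "p \<in> D"
    and f: "is_integral_from D p0 c \<alpha> f" and g: "is_integral_from D p0 c \<beta> g"
    and eq: "\<And>q. q \<in> D \<Longrightarrow> \<alpha> q = \<beta> q"
  shows "f p = g p"
proof -
  obtain \<gamma> where \<gamma>: "polynomial_function \<gamma>" "path_image \<gamma> \<subseteq> D" "pathstart \<gamma> = p0" "pathfinish \<gamma> = p"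
    using connected_open_polynomial_connected[OF assms(1-4)] by blast
  have v: "valid_path \<gamma>"
    unfolding valid_path_def
    using \<gamma>(1) by (intro C1_differentiable_imp_piecewise) (rule C1_differentiable_polynomial_function)
  have "has_line_integral \<alpha> (f p - c) \<gamma>" "has_line_integral \<beta> (g p - c) \<gamma>"
    using f g v \<gamma> unfolding is_integral_from_def by blast+
  moreover have "\<alpha> (\<gamma> t) = \<beta> (\<gamma> t)" if "t \<in> {0..1}" for t
    by (rule eq) (use that \<gamma>(2) in \<open>auto simp: path_image_def\<close>)
  ultimately have "has_line_integral \<alpha> (f p - c) \<gamma>" "has_line_integral \<alpha> (g p - c) \<gamma>"
    unfolding has_line_integral_def
    using has_integral_cong[of "{0..1}" "\<lambda>s. \<alpha> (\<gamma> s) \<bullet> vector_derivative \<gamma> (at s within {0..1})"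
        "\<lambda>s. \<beta> (\<gamma> s) \<bullet> vector_derivative \<gamma> (at s within {0..1})"]
    by simp_all
  then have "f p - c = g p - c"
    unfolding has_line_integral_def by (rule has_integral_unique)
  then show ?thesis by simp
qed


section \<open>The divergence theorem in null coordinates\<close>

text \<open>
  By Fubini's theorem, integrate \<open>P'\<close> along horizontal and \<open>Q'\<close> along vertical segments of a box around \<open>K\<close>;
  \<open>P\<close> and \<open>Q\<close> vanish at the end points of these segments.
\<close>

lemma has_integral_divergence_compact_support:
  fixes P Q :: "real \<times> real \<Rightarrow> real"
  assumes P: "\<And>p. (P has_derivative P' p) (at p)" and Q: "\<And>p. (Q has_derivative Q' p) (at p)"
    and cont: "continuous_on UNIV (\<lambda>p. P' p (1, 0))" "continuous_on UNIV (\<lambda>p. Q' p (0, 1))"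
    and "compact K" and zero: "\<And>p. p \<notin> K \<Longrightarrow> P p = 0" "\<And>p. p \<notin> K \<Longrightarrow> Q p = 0"
  shows "((\<lambda>p. P' p (1, 0) + Q' p (0, 1)) has_integral 0) K"
proof -
  obtain a where "K \<subseteq> box (-a) a"
    using bounded_subset_box_symmetric[OF compact_imp_bounded[OF \<open>compact K\<close>]] by blast
  then obtain l m where K: "K \<subseteq> box (-l, -m) (l, m)" by (cases a) auto
  have out: "(x, y) \<notin> K" if "x = l \<or> x = -l \<or> y = m \<or> y = -m" for x y
    using that K by (auto simp: subset_iff mem_box Basis_prod_def)
  have Px: "((\<lambda>x. P (x, y)) has_vector_derivative P' (x, y) (1, 0)) (at x)" for x y
    using has_vector_derivative_slice1[OF P[of "(x, y)"]] by simp
  have Qy: "((\<lambda>y. Q (x, y)) has_vector_derivative Q' (x, y) (0, 1)) (at y)" for x y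
    using has_vector_derivative_slice2[OF Q[of "(x, y)"]] by simp
  have intP: "integral (cbox (-l) l) (\<lambda>x. P' (x, y) (1, 0)) = 0" for y
  proof (cases "-l \<le> l")
    case True
    have "((\<lambda>x. P' (x, y) (1, 0)) has_integral (P (l, y) - P (-l, y))) {-l..l}"
      using True Px by (intro fundamental_theorem_of_calculus) (auto intro: has_vector_derivative_at_within)
    then show ?thesis using out zero(1) by (simp add: integral_unique)
  qed simp
  have intQ: "integral (cbox (-m) m) (\<lambda>y. Q' (x, y) (0, 1)) = 0" for x
  proof (cases "-m \<le> m")
    case True
    have "((\<lambda>y. Q' (x, y) (0, 1)) has_integral (Q (x, m) - Q (x, -m))) {-m..m}"
      using True Qy by (intro fundamental_theorem_of_calculus) (auto intro: has_vector_derivative_at_within)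
    then show ?thesis using out zero(2) by (simp add: integral_unique)
  qed simp
  define B where "B = cbox (-l, -m) (l, m)"
  have contP: "continuous_on B (\<lambda>p. P' p (1, 0))" and contQ: "continuous_on B (\<lambda>p. Q' p (0, 1))"
    using cont continuous_on_subset by blast+
  have "integral B (\<lambda>p. P' p (1, 0)) =
      integral (cbox (-l) l) (\<lambda>x. integral (cbox (-m) m) (\<lambda>y. P' (x, y) (1, 0)))"
    using contP unfolding B_def by (rule integral_prod_continuous)
  also have "\<dots> = integral (cbox (-m) m) (\<lambda>y. integral (cbox (-l) l) (\<lambda>x. P' (x, y) (1, 0)))"
    using contP unfolding B_def by (intro integral_swap_continuous) (simp add: case_prod_unfold)
  finally have "((\<lambda>p. P' p (1, 0)) has_integral 0) B"
    using integrable_continuous[OF contP[unfolded B_def]] intP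
    by (simp add: B_def has_integral_iff)
  moreover have "integral B (\<lambda>p. Q' p (0, 1)) =
      integral (cbox (-l) l) (\<lambda>x. integral (cbox (-m) m) (\<lambda>y. Q' (x, y) (0, 1)))"
    using contQ unfolding B_def by (rule integral_prod_continuous)
  then have "((\<lambda>p. Q' p (0, 1)) has_integral 0) B"
    using integrable_continuous[OF contQ[unfolded B_def]] intQ
    by (simp add: B_def has_integral_iff)
  ultimately have B: "((\<lambda>p. P' p (1, 0) + Q' p (0, 1)) has_integral 0) B"
    using has_integral_add[of "\<lambda>p. P' p (1, 0)" 0 B "\<lambda>p. Q' p (0, 1)" 0] by simp
  have flat: "R' = (\<lambda>_. 0)" if R: "(R has_derivative R') (at p)" and "p \<notin> K"
    and "\<And>p. p \<notin> K \<Longrightarrow> R p = 0" for R :: "real \<times> real \<Rightarrow> real" and R' p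
  proof -
    have "open (- K)" using \<open>compact K\<close> by (simp add: compact_imp_closed open_Compl)
    then have "(R has_derivative (\<lambda>_. 0)) (at p)"
      using that by (intro has_derivative_transform_within_open[OF has_derivative_const, of "- K" p 0]) auto
    then show ?thesis by (rule has_derivative_unique[OF R])
  qed
  have "K \<subseteq> B" using K box_subset_cbox unfolding B_def by blast
  moreover have "P' p (1, 0) + Q' p (0, 1) = 0" if "p \<notin> K" for p
    using flat[of P "P' p" p] flat[of Q "Q' p" p] P Q zero that by simp
  ultimately have "((\<lambda>p. if p \<in> K then P' p (1, 0) + Q' p (0, 1) else 0) has_integral 0) B"
    by (subst has_integral_cong[where g="\<lambda>p. P' p (1, 0) + Q' p (0, 1)"]) (use B in auto)
  then show ?thesis using \<open>K \<subseteq> B\<close> by (simp add: has_integral_restrict)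
qed

lemma null_coords_eq: "null_coords p = (fst p + snd p, - fst p + snd p)"
  by (simp add: null_coords_def case_prod_unfold)

lemma bounded_linear_null_coords: "bounded_linear null_coords"
proof -
  have N: "null_coords = (\<lambda>p. (fst p + snd p, snd p - fst p))" by (auto simp: fun_eq_iff null_coords_eq)
  show ?thesis
    unfolding N by (intro bounded_linear_Pair bounded_linear_add bounded_linear_sub bounded_linear_fst bounded_linear_snd)
qed

lemma has_derivative_null_coords: "(null_coords has_derivative null_coords) (at q)"
  by (rule bounded_linear_imp_has_derivative[OF bounded_linear_null_coords])

lemma compact_vimage_null_coords:
  assumes "compact K"
  shows "compact (null_coords -` K)"
proof -
  define M where "M p = ((fst p - snd p) / 2, (fst p + snd p) / 2)" for p :: "real \<times> real"
  have "null_coords (M p) = p" "M (null_coords p) = p" for p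
    by (auto simp: M_def null_coords_eq prod_eq_iff field_simps)
  then have "null_coords -` K = M ` K" by (metis (no_types, opaque_lifting) image_iff subsetI subset_antisym vimageE vimageI2)
  moreover have "continuous_on K M"
    unfolding M_def by (intro continuous_intros) auto
  ultimately show ?thesis using compact_continuous_image assms by metis
qed

text \<open>
  In the coordinates \<open>(t, x)\<close> the divergence \<open>X\<^sub>u + Y\<^sub>v\<close> is \<open>P\<^sub>t + Q\<^sub>x\<close> with \<open>P = (X - Y) / 2\<close> and \<open>Q = (X + Y) / 2\<close>. Extended
  by zero, \<open>X\<close> and \<open>Y\<close> are \<open>C\<^sup>1\<close> on the whole plane, since \<open>D\<close> and the complement of \<open>K\<close> are open sets that
  cover it.
\<close>

lemma has_integral_null_divergence:
  fixes X Y :: "real \<times> real \<Rightarrow> real"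
  assumes "open D" "compact K" "K \<subseteq> D" and X: "Ck_on 1 D X" and Y: "Ck_on 1 D Y"
    and zero: "\<And>p. p \<in> D - K \<Longrightarrow> X p = 0" "\<And>p. p \<in> D - K \<Longrightarrow> Y p = 0"
  shows "((\<lambda>q. partial1 X (null_coords q) + partial2 Y (null_coords q)) has_integral 0) (null_coords -` K)"
proof -
  define ext where "ext f p = (if p \<in> D then f p else 0)" for f :: "real \<times> real \<Rightarrow> real" and p
  define d where "d f p = (if p \<in> D then frechet_derivative f (at p) else (\<lambda>_. 0))"
    for f :: "real \<times> real \<Rightarrow> real" and p
  have "open (- K)" using \<open>compact K\<close> by (simp add: compact_imp_closed open_Compl)
  have df: "(f has_derivative frechet_derivative f (at p)) (at p)"
    if "Ck_on 1 D f" "p \<in> D" for f :: "real \<times> real \<Rightarrow> real" and p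
    using Ck_on_Suc_has_derivative[of 0] that by (simp del: Ck_on.simps)
  have ext: "(ext f has_derivative d f p) (at p)" "continuous_on UNIV (\<lambda>p. d f p h)"
    if f: "Ck_on 1 D f" and z: "\<And>p. p \<in> D - K \<Longrightarrow> f p = 0" for f p h
  proof -
    have extz: "ext f p = 0" if "p \<in> - K" for p
      using that z \<open>K \<subseteq> D\<close> by (auto simp: ext_def)
    then have 0: "(ext f has_derivative (\<lambda>_. 0)) (at p)" if "p \<in> - K" for p
      by (intro has_derivative_transform_within_open[OF has_derivative_const \<open>open (- K)\<close> that]) simp
    have 1: "(ext f has_derivative d f p) (at p)" if "p \<in> D" for p
      unfolding d_def using that
      by (auto intro!: has_derivative_transform_within_open[OF df[OF f that] \<open>open D\<close> that] simp: ext_def)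
    show ext': "(ext f has_derivative d f p) (at p)" for p
    proof (cases "p \<in> D")
      case False
      then have "p \<in> - K" using \<open>K \<subseteq> D\<close> by blast
      from 0[OF this] False show ?thesis by (simp add: d_def)
    qed (rule 1)
    have "d f p = (\<lambda>_. 0)" if "p \<in> - K" for p
      by (rule has_derivative_unique[OF ext' 0[OF that]])
    then have "continuous_on (- K) (\<lambda>p. d f p h)"
      by (intro continuous_on_eq[OF continuous_on_const[of _ 0]]) simp
    moreover have "continuous_on D (\<lambda>p. d f p h)"
      using Ck_on_Suc_continuous[OF f[unfolded One_nat_def]] by (simp add: d_def cong: continuous_on_cong)
    ultimately have "continuous_on (D \<union> - K) (\<lambda>p. d f p h)"
      using \<open>open D\<close> \<open>open (- K)\<close> by (intro continuous_on_open_Un)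
    moreover have "D \<union> - K = UNIV" using \<open>K \<subseteq> D\<close> by blast
    ultimately show "continuous_on UNIV (\<lambda>p. d f p h)" by simp
  qed
  let ?N = null_coords
  have comp: "((\<lambda>q. ext f (?N q)) has_derivative (\<lambda>h. d f (?N q) (?N h))) (at q)"
    if "Ck_on 1 D f" "\<And>p. p \<in> D - K \<Longrightarrow> f p = 0" for f q
    by (rule has_derivative_compose[OF has_derivative_null_coords ext(1)[OF that]])
  have contN: "continuous_on UNIV (\<lambda>q. d f (?N q) h)"
    if "Ck_on 1 D f" "\<And>p. p \<in> D - K \<Longrightarrow> f p = 0" for f h
    by (rule continuous_on_compose2[OF ext(2)[OF that]])
      (use linear_continuous_on[OF bounded_linear_null_coords] in auto)
  have extN: "ext f (?N q) = 0" if "?N q \<notin> K" "\<And>p. p \<in> D - K \<Longrightarrow> f p = 0" for f q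
    using that by (auto simp: ext_def)
  have "((\<lambda>q. (d X (?N q) (?N (1, 0)) - d Y (?N q) (?N (1, 0))) / 2
      + (d X (?N q) (?N (0, 1)) + d Y (?N q) (?N (0, 1))) / 2) has_integral 0) (?N -` K)"
  proof (rule has_integral_divergence_compact_support)
    show "((\<lambda>q. (ext X (?N q) - ext Y (?N q)) / 2) has_derivative
        (\<lambda>h. (d X (?N q) (?N h) - d Y (?N q) (?N h)) / 2)) (at q)" for q
      by (rule has_derivative_eq_rhs[OF has_derivative_mult_left[OF has_derivative_diff[OF comp[OF X zero(1)] comp[OF Y zero(2)]], of "1/2", unfolded times_divide_eq_right mult_1_right]])
        (assumption | rule refl)+
    show "((\<lambda>q. (ext X (?N q) + ext Y (?N q)) / 2) has_derivative
        (\<lambda>h. (d X (?N q) (?N h) + d Y (?N q) (?N h)) / 2)) (at q)" for q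
      by (rule has_derivative_eq_rhs[OF has_derivative_mult_left[OF has_derivative_add[OF comp[OF X zero(1)] comp[OF Y zero(2)]], of "1/2", unfolded times_divide_eq_right mult_1_right]])
        (assumption | rule refl)+
    show "continuous_on UNIV (\<lambda>q. (d X (?N q) (?N (1, 0)) - d Y (?N q) (?N (1, 0))) / 2)"
      by (intro continuous_intros contN[OF X zero(1)] contN[OF Y zero(2)]) auto
    show "continuous_on UNIV (\<lambda>q. (d X (?N q) (?N (0, 1)) + d Y (?N q) (?N (0, 1))) / 2)"
      by (intro continuous_intros contN[OF X zero(1)] contN[OF Y zero(2)]) auto
    show "compact (?N -` K)" by (rule compact_vimage_null_coords[OF \<open>compact K\<close>])
  qed (use extN[OF _ zero(1)] extN[OF _ zero(2)] in \<open>simp_all\<close>)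
  moreover have "(d X (?N q) (?N (1, 0)) - d Y (?N q) (?N (1, 0))) / 2
      + (d X (?N q) (?N (0, 1)) + d Y (?N q) (?N (0, 1))) / 2
      = partial1 X (?N q) + partial2 Y (?N q)" if "q \<in> ?N -` K" for q
  proof -
    have q: "?N q \<in> D" using that \<open>K \<subseteq> D\<close> by blast
    have "d f (?N q) h = partial1 f (?N q) * fst h + partial2 f (?N q) * snd h" if "Ck_on 1 D f" for f h
      using has_derivative_partials[OF df[OF that q], of h] q by (simp add: d_def)
    moreover have "?N (1, 0) = (1, -1)" "?N (0, 1) = (1, 1)" by (simp_all add: null_coords_eq)
    ultimately show ?thesis using X Y by (simp add: field_simps)
  qed
  ultimately show ?thesis by (rule has_integral_eq[rotated])
qed


section \<open>The energy density in null coordinates\<close>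

lemma G_metric_eq:
  "G_metric \<mu>1 \<mu>2 x a b = - (fst a * fst b) + exp (- 2 * \<mu>1 * fst x) * (fst (snd a) * fst (snd b))
     + exp (- 2 * \<mu>2 * fst x) * (snd (snd a) * snd (snd b))"
  by (cases x; cases a; cases b) simp

lemma G_metric_polarization:
  "- G_metric \<mu>1 \<mu>2 x (a - b) (a - b) + G_metric \<mu>1 \<mu>2 x (a + b) (a + b) = 4 * G_metric \<mu>1 \<mu>2 x a b"
  by (cases x; cases a; cases b) (simp add: algebra_simps)

text \<open>
  Since \<open>\<psi>\<^sub>t = \<psi>\<^sub>u - \<psi>\<^sub>v\<close> and \<open>\<psi>\<^sub>x = \<psi>\<^sub>u + \<psi>\<^sub>v\<close>, polarization turns the density into \<open>2 \<langle>\<psi>\<^sub>u, \<psi>\<^sub>v\<rangle>\<close>.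
\<close>

lemma energy_density_null_coords:
  assumes "(\<psi> has_derivative A) (at (null_coords q))"
  shows "energy_density \<mu>1 \<mu>2 (\<psi> \<circ> null_coords) q
    = 2 * G_metric \<mu>1 \<mu>2 (\<psi> (null_coords q)) (A (1, 0)) (A (0, 1))"
proof -
  interpret bounded_linear A using assms by (rule has_derivative_bounded_linear)
  have D: "(\<psi> \<circ> null_coords has_derivative (\<lambda>h. A (null_coords h))) (at q)"
    unfolding o_def by (rule has_derivative_compose[OF has_derivative_null_coords assms])
  have "partial1 (\<psi> \<circ> null_coords) q = A (1, 0) - A (0, 1)"
    "partial2 (\<psi> \<circ> null_coords) q = A (1, 0) + A (0, 1)"
    unfolding partial1_eq[OF D] partial2_eq[OF D] by (simp_all add: null_coords_eq flip: add diff)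
  then show ?thesis
    using G_metric_polarization[of \<mu>1 \<mu>2 "\<psi> (null_coords q)" "A (1, 0)" "A (0, 1)"]
    by (simp add: energy_density_def)
qed


section \<open>Second-order estimates\<close>

text \<open>
  The mean value theorem in \<open>s\<close>, with the derivative bounded on the compact set \<open>{-\<delta>..\<delta>} \<times> K\<close>.
\<close>

lemma uniform_increment_bound:
  fixes g :: "real \<times> 'a::real_normed_vector \<Rightarrow> 'b::real_normed_vector"
  assumes g: "Ck_on 1 ({-\<epsilon><..<\<epsilon>} \<times> D) g" and "compact K" "K \<subseteq> D" and \<delta>: "0 < \<delta>" "\<delta> < \<epsilon>"
  shows "\<exists>C. \<forall>s p. \<bar>s\<bar> \<le> \<delta> \<longrightarrow> p \<in> K \<longrightarrow> norm (g (s, p) - g (0, p)) \<le> C * \<bar>s\<bar>"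
proof -
  define g' where "g' q = frechet_derivative g (at q) (1, 0)" for q
  have sub: "{-\<delta>..\<delta>} \<times> K \<subseteq> {-\<epsilon><..<\<epsilon>} \<times> D" using \<delta> \<open>K \<subseteq> D\<close> by auto
  have "continuous_on ({-\<epsilon><..<\<epsilon>} \<times> D) g'"
    unfolding g'_def by (rule Ck_on_Suc_continuous[OF g[unfolded One_nat_def]])
  then have "continuous_on ({-\<delta>..\<delta>} \<times> K) g'" using sub by (rule continuous_on_subset)
  then have "compact (g' ` ({-\<delta>..\<delta>} \<times> K))"
    using \<open>compact K\<close> by (intro compact_continuous_image compact_Times) auto
  then obtain C where C: "\<And>q. q \<in> {-\<delta>..\<delta>} \<times> K \<Longrightarrow> norm (g' q) \<le> C"
    by (meson bounded_iff compact_imp_bounded imageI)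
  have "norm (g (s, p) - g (0, p)) \<le> C * norm (s - 0)" if s: "\<bar>s\<bar> \<le> \<delta>" and p: "p \<in> K" for s p
  proof (rule differentiable_bound[where S="{-\<delta>..\<delta>}" and f'="\<lambda>t h. h *\<^sub>R g' (t, p)"])
    fix t assume t: "t \<in> {-\<delta>..\<delta>}"
    have "(t, p) \<in> {-\<epsilon><..<\<epsilon>} \<times> D" using sub t p by blast
    then have d: "(g has_derivative frechet_derivative g (at (t, p))) (at (t, p))"
      using Ck_on_Suc_has_derivative[OF g[unfolded One_nat_def]] by blast
    interpret bounded_linear "frechet_derivative g (at (t, p))"
      using d by (rule has_derivative_bounded_linear)
    have "((\<lambda>t. g (t, p)) has_derivative (\<lambda>h. frechet_derivative g (at (t, p)) (h, 0))) (at t)"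
      by (rule has_derivative_compose[OF has_derivative_Pair[OF has_derivative_ident has_derivative_const] d])
    moreover have "(\<lambda>h. frechet_derivative g (at (t, p)) (h, 0)) = (\<lambda>h. h *\<^sub>R g' (t, p))"
      by (simp add: g'_def flip: scale)
    ultimately show "((\<lambda>t. g (t, p)) has_derivative (\<lambda>h. h *\<^sub>R g' (t, p))) (at t within {-\<delta>..\<delta>})"
      by (simp add: has_derivative_at_withinI)
    show "onorm (\<lambda>h. h *\<^sub>R g' (t, p)) \<le> C"
      by (rule onorm_le) (use C[of "(t, p)"] t p in \<open>auto simp: mult.commute[of C] intro: mult_left_mono\<close>)
  qed (use s \<delta> in auto)
  then show ?thesis by auto
qed

text \<open>
  The remainder is \<open>(exp y - 1 - y) a b + (exp y - 1) (a B + A b) + exp y A B\<close>, and by Taylor's formula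
  \<open>exp y - 1\<close> and \<open>exp y - 1 - y\<close> are of first and second order in \<open>y\<close>.
\<close>

lemma exp_product_remainder_bound:
  fixes a b A B y r M :: real
  assumes "\<bar>a\<bar> \<le> M" "\<bar>b\<bar> \<le> M" "\<bar>A\<bar> \<le> M * r" "\<bar>B\<bar> \<le> M * r" "\<bar>y\<bar> \<le> M * r"
    and r: "0 \<le> r" "r \<le> 1" and M: "1 \<le> M"
  shows "\<bar>exp y * ((a + A) * (b + B)) - a * b - (y * a * b + a * B + A * b)\<bar> \<le> 4 * exp M * M ^ 4 * r\<^sup>2"
proof -
  have Mr: "M * r \<le> M" "0 \<le> M * r" using r M by (auto intro: mult_left_le)
  have small: "\<bar>exp t\<bar> \<le> exp M" if "\<bar>t\<bar> \<le> \<bar>y\<bar>" for t using that assms(5) Mr by auto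
  obtain t1 where t1: "\<bar>t1\<bar> \<le> \<bar>y\<bar>" "exp y = (\<Sum>m<1. y ^ m / fact m) + exp t1 / fact 1 * y ^ 1"
    using Maclaurin_exp_le[of y 1] by blast
  obtain t2 where t2: "\<bar>t2\<bar> \<le> \<bar>y\<bar>" "exp y = (\<Sum>m<2. y ^ m / fact m) + exp t2 / fact 2 * y ^ 2"
    using Maclaurin_exp_le[of y 2] by blast
  have e1: "exp y - 1 = exp t1 * y" using t1 by simp
  have e2: "exp y - 1 - y = exp t2 * y\<^sup>2 / 2" using t2 by (simp add: numeral_2_eq_2)
  have y2: "\<bar>y\<bar> * \<bar>y\<bar> \<le> (M * r) * (M * r)" using assms(5) by (intro mult_mono) auto
  have "\<bar>(exp y - 1 - y) * (a * b)\<bar> = \<bar>exp t2\<bar> * (\<bar>y\<bar> * \<bar>y\<bar>) / 2 * (\<bar>a\<bar> * \<bar>b\<bar>)"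
    unfolding e2 by (simp add: abs_mult power2_eq_square)
  also have "\<dots> \<le> exp M * ((M * r) * (M * r)) / 2 * (M * M)"
    using small[OF t2(1)] y2 assms(1,2,5) M Mr by (intro mult_mono divide_right_mono) auto
  also have "\<dots> \<le> exp M * M ^ 4 * r\<^sup>2"
    using M r by (auto simp: power2_eq_square power4_eq_xxxx intro!: mult_nonneg_nonneg)
  finally have 1: "\<bar>(exp y - 1 - y) * (a * b)\<bar> \<le> exp M * M ^ 4 * r\<^sup>2" .
  have "\<bar>a * B + A * b\<bar> \<le> M * (M * r) + (M * r) * M"
    using assms(1-4) M Mr by (intro order_trans[OF abs_triangle_ineq] add_mono)
      (auto simp: abs_mult intro!: mult_mono)
  then have "\<bar>exp t1 * y * (a * B + A * b)\<bar> \<le> exp M * (M * r) * (M * (M * r) + (M * r) * M)"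
    using small[OF t1(1)] assms(5) M Mr unfolding abs_mult by (intro mult_mono) auto
  also have "\<dots> = 2 * exp M * M ^ 3 * r\<^sup>2"
    by (simp add: power2_eq_square power3_eq_cube)
  also have "\<dots> \<le> 2 * exp M * M ^ 4 * r\<^sup>2"
    using M by (intro mult_right_mono mult_left_mono power_increasing) auto
  finally have 2: "\<bar>(exp y - 1) * (a * B + A * b)\<bar> \<le> 2 * exp M * M ^ 4 * r\<^sup>2" unfolding e1 .
  have "\<bar>exp y * (A * B)\<bar> \<le> exp M * ((M * r) * (M * r))"
    using small[of y] assms(3,4) Mr unfolding abs_mult by (intro mult_mono) auto
  also have "\<dots> = exp M * M ^ 2 * r\<^sup>2" by (simp add: power2_eq_square)
  also have "\<dots> \<le> exp M * M ^ 4 * r\<^sup>2"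
    using M by (intro mult_right_mono mult_left_mono power_increasing) auto
  finally have 3: "\<bar>exp y * (A * B)\<bar> \<le> exp M * M ^ 4 * r\<^sup>2" .
  have "exp y * ((a + A) * (b + B)) - a * b - (y * a * b + a * B + A * b)
      = (exp y - 1 - y) * (a * b) + (exp y - 1) * (a * B + A * b) + exp y * (A * B)"
    by (simp add: algebra_simps)
  then show ?thesis using 1 2 3 by linarith
qed

lemma continuous_on_compact_bound:
  fixes f :: "'a::topological_space \<Rightarrow> real"
  assumes "compact K" "continuous_on K f"
  shows "\<exists>M. \<forall>p\<in>K. \<bar>f p\<bar> \<le> M"
  using compact_imp_bounded[OF compact_continuous_image[OF assms(2,1)]]
  by (auto simp: bounded_iff)

text \<open>
  \<open>e\<close> times what is left of \<open>exp y (a + A) (b + B)\<close> after removing its terms of order at most one in \<open>(y, A, B)\<close>.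
\<close>

definition second_order_remainder :: "real \<Rightarrow> real \<Rightarrow> real \<Rightarrow> real \<Rightarrow> real \<Rightarrow> real \<Rightarrow> real" where
  "second_order_remainder e y a b A B
     = e * (exp y * ((a + A) * (b + B)) - a * b - (y * a * b + a * B + A * b))"

lemma exp_product_remainder_uniform:
  fixes a b e :: "'a::topological_space \<Rightarrow> real" and A B y :: "real \<Rightarrow> 'a \<Rightarrow> real"
  assumes "compact K" "continuous_on K a" "continuous_on K b" "continuous_on K e" and \<delta>: "\<delta> \<le> 1"
    and A: "\<exists>C. \<forall>s p. \<bar>s\<bar> \<le> \<delta> \<longrightarrow> p \<in> K \<longrightarrow> \<bar>A s p\<bar> \<le> C * \<bar>s\<bar>"
    and B: "\<exists>C. \<forall>s p. \<bar>s\<bar> \<le> \<delta> \<longrightarrow> p \<in> K \<longrightarrow> \<bar>B s p\<bar> \<le> C * \<bar>s\<bar>"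
    and y: "\<exists>C. \<forall>s p. \<bar>s\<bar> \<le> \<delta> \<longrightarrow> p \<in> K \<longrightarrow> \<bar>y s p\<bar> \<le> C * \<bar>s\<bar>"
  shows "\<exists>C. \<forall>s p. \<bar>s\<bar> \<le> \<delta> \<longrightarrow> p \<in> K \<longrightarrow>
    \<bar>second_order_remainder (e p) (y s p) (a p) (b p) (A s p) (B s p)\<bar> \<le> C * s\<^sup>2"
proof -
  obtain Ca Cb Ce where 1: "\<And>p. p \<in> K \<Longrightarrow> \<bar>a p\<bar> \<le> Ca" "\<And>p. p \<in> K \<Longrightarrow> \<bar>b p\<bar> \<le> Cb"
    "\<And>p. p \<in> K \<Longrightarrow> \<bar>e p\<bar> \<le> Ce"
    using continuous_on_compact_bound[OF assms(1)] assms(2-4) by metis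
  obtain CA CB Cy where 2: "\<And>s p. \<bar>s\<bar> \<le> \<delta> \<Longrightarrow> p \<in> K \<Longrightarrow> \<bar>A s p\<bar> \<le> CA * \<bar>s\<bar>"
    "\<And>s p. \<bar>s\<bar> \<le> \<delta> \<Longrightarrow> p \<in> K \<Longrightarrow> \<bar>B s p\<bar> \<le> CB * \<bar>s\<bar>"
    "\<And>s p. \<bar>s\<bar> \<le> \<delta> \<Longrightarrow> p \<in> K \<Longrightarrow> \<bar>y s p\<bar> \<le> Cy * \<bar>s\<bar>"
    using A B y by metis
  define M where "M = Max {1, Ca, Cb, CA, CB, Cy}"
  have M: "1 \<le> M" "Ca \<le> M" "Cb \<le> M" "CA \<le> M" "CB \<le> M" "Cy \<le> M" by (simp_all add: M_def)
  have "\<bar>second_order_remainder (e p) (y s p) (a p) (b p) (A s p) (B s p)\<bar> \<le> Ce * (4 * exp M * M ^ 4) * s\<^sup>2"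
    if s: "\<bar>s\<bar> \<le> \<delta>" and p: "p \<in> K" for s p
  proof -
    have "\<bar>exp (y s p) * ((a p + A s p) * (b p + B s p)) - a p * b p
      - (y s p * a p * b p + a p * B s p + A s p * b p)\<bar> \<le> 4 * exp M * M ^ 4 * \<bar>s\<bar>\<^sup>2"
    proof (rule exp_product_remainder_bound)
      show "\<bar>a p\<bar> \<le> M" "\<bar>b p\<bar> \<le> M" using 1[OF p] M by linarith+
      show "\<bar>A s p\<bar> \<le> M * \<bar>s\<bar>" "\<bar>B s p\<bar> \<le> M * \<bar>s\<bar>" "\<bar>y s p\<bar> \<le> M * \<bar>s\<bar>"
        using 2[OF s p] M(4-6)[THEN mult_right_mono[OF _ abs_ge_zero[of s]]] by linarith+
    qed (use s \<delta> M in auto)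
    then have "\<bar>e p\<bar> * \<bar>exp (y s p) * ((a p + A s p) * (b p + B s p)) - a p * b p
      - (y s p * a p * b p + a p * B s p + A s p * b p)\<bar> \<le> Ce * (4 * exp M * M ^ 4 * \<bar>s\<bar>\<^sup>2)"
      using 1(3)[OF p] by (intro mult_mono) auto
    then show ?thesis by (simp add: second_order_remainder_def abs_mult mult.assoc)
  qed
  then show ?thesis by blast
qed

text \<open>
  The increment of one spatial term of the metric, minus its linear part, when the first coordinate
  moves from \<open>x\<close> to \<open>x + v\<close> and vectors with left-invariant components \<open>a\<close>, \<open>b\<close> at \<open>x\<close> are changed by \<open>A\<close>, \<open>B\<close>.
  The linear part simplifies because \<open>exp (- 2 \<mu> x) exp (\<mu> x) = exp (- \<mu> x)\<close>.
\<close>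

lemma G_metric_term_expansion:
  fixes \<mu> x v a b A B :: real
  shows "exp (- 2 * \<mu> * (x + v)) * ((exp (\<mu> * x) * a + A) * (exp (\<mu> * x) * b + B))
      - exp (- 2 * \<mu> * x) * ((exp (\<mu> * x) * a) * (exp (\<mu> * x) * b))
      - (exp (- \<mu> * x) * (A * b + B * a) - 2 * \<mu> * v * a * b)
    = second_order_remainder (exp (- 2 * \<mu> * x)) (- 2 * \<mu> * v) (exp (\<mu> * x) * a) (exp (\<mu> * x) * b) A B"
proof -
  define z w q where "z = exp (- \<mu> * x)" and "w = exp (\<mu> * x)" and "q = exp (- 2 * \<mu> * v)"
  have z: "exp (- 2 * \<mu> * x) = z * z" "exp (- 2 * \<mu> * (x + v)) = z * z * q"
    unfolding z_def q_def mult_exp_exp by (rule arg_cong[where f=exp], simp add: algebra_simps)+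
  have "z * w = 1" unfolding z_def w_def mult_exp_exp by simp
  then show ?thesis
    unfolding second_order_remainder_def z z_def[symmetric] w_def[symmetric] q_def[symmetric] by algebra
qed

lemma has_derivative_zero_if_quadratic_bound:
  fixes f :: "real \<Rightarrow> real"
  assumes "0 < \<delta>" and f: "\<And>s. \<bar>s\<bar> \<le> \<delta> \<Longrightarrow> \<bar>f s - f 0\<bar> \<le> C * s\<^sup>2"
  shows "(f has_real_derivative 0) (at 0)"
  unfolding DERIV_def
proof (rule Lim_null_comparison)
  have "\<forall>\<^sub>F h in at (0::real). \<bar>h\<bar> < \<delta>"
    using \<open>0 < \<delta>\<close> by (auto simp: eventually_at intro!: exI[of _ \<delta>])
  then show "\<forall>\<^sub>F h in at 0. norm ((f (0 + h) - f 0) / h) \<le> C * \<bar>h\<bar>"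
  proof (eventually_elim)
    case (elim h)
    then show ?case
      using f[of h] by (cases "h = 0") (auto simp: abs_mult power2_eq_square divide_simps)
  qed
  have "((\<lambda>h. C * \<bar>h\<bar>) \<longlongrightarrow> C * \<bar>0\<bar>) (at (0::real))"
    by (intro tendsto_intros)
  then show "((\<lambda>h. C * \<bar>h\<bar>) \<longlongrightarrow> 0) (at (0::real))" by simp
qed


section \<open>Harmonic maps from null frames\<close>

lemma integrable_on_compact_continuous:
  fixes f :: "'a::euclidean_space \<Rightarrow> real"
  assumes "compact K" "continuous_on K f"
  shows "f integrable_on K"
  using borel_integrable_compact[OF assms] set_borel_integral_eq_integral(1)
  unfolding set_integrable_def by blast

text \<open>
  The functions \<open>\<xi>i\<close> and \<open>\<eta>i\<close> are the left-invariant components of \<open>\<phi>\<^sub>u\<close> and \<open>\<phi>\<^sub>v\<close>; \<open>eq0\<close>, \<open>eq1\<close>, \<open>eq2\<close> are the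
  Euler-Lagrange equations of the energy in these components.
\<close>

lemma harmonic_map_of_null_frame:
  fixes \<mu>1 \<mu>2 :: real and x0 x1 x2 \<xi>0 \<xi>1 \<xi>2 \<eta>0 \<eta>1 \<eta>2 :: "real \<times> real \<Rightarrow> real"
  assumes "open D"
    and smooth: "smooth_on D (\<lambda>p. (x0 p, x1 p, x2 p))"
    and C1: "Ck_on 1 D \<xi>0" "Ck_on 1 D \<xi>1" "Ck_on 1 D \<xi>2" "Ck_on 1 D \<eta>0" "Ck_on 1 D \<eta>1" "Ck_on 1 D \<eta>2"
    and dx0: "\<And>p. p \<in> D \<Longrightarrow> (x0 has_derivative (\<lambda>h. \<xi>0 p * fst h + \<eta>0 p * snd h)) (at p)"
    and dx1: "\<And>p. p \<in> D \<Longrightarrow> (x1 has_derivative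
        (\<lambda>h. exp (\<mu>1 * x0 p) * \<xi>1 p * fst h + exp (\<mu>1 * x0 p) * \<eta>1 p * snd h)) (at p)"
    and dx2: "\<And>p. p \<in> D \<Longrightarrow> (x2 has_derivative
        (\<lambda>h. exp (\<mu>2 * x0 p) * \<xi>2 p * fst h + exp (\<mu>2 * x0 p) * \<eta>2 p * snd h)) (at p)"
    and eq0: "\<And>p. p \<in> D \<Longrightarrow> partial1 \<eta>0 p + partial2 \<xi>0 p = 2 * (\<mu>1 * \<xi>1 p * \<eta>1 p + \<mu>2 * \<xi>2 p * \<eta>2 p)"
    and eq1: "\<And>p. p \<in> D \<Longrightarrow> partial1 \<eta>1 p + partial2 \<xi>1 p = \<mu>1 * (\<xi>0 p * \<eta>1 p + \<eta>0 p * \<xi>1 p)"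
    and eq2: "\<And>p. p \<in> D \<Longrightarrow> partial1 \<eta>2 p + partial2 \<xi>2 p = \<mu>2 * (\<xi>0 p * \<eta>2 p + \<eta>0 p * \<xi>2 p)"
  shows "harmonic_map \<mu>1 \<mu>2 D (\<lambda>p. (x0 p, x1 p, x2 p))"
  unfolding harmonic_map_def
proof (intro conjI allI impI, rule smooth, elim conjE)
  define \<phi> where "\<phi> = (\<lambda>p. (x0 p, x1 p, x2 p))"
  fix K \<epsilon> \<Phi>
  assume K: "compact K" "K \<subseteq> D" and "0 < \<epsilon>"
    and var: "smooth_variation D K \<epsilon> (\<lambda>p. (x0 p, x1 p, x2 p)) \<Phi>"
  define I where "I = {-\<epsilon><..<\<epsilon>}"
  define \<Psi> where "\<Psi> = (\<lambda>(s, p). \<Phi> s p)"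
  define E where "E q = frechet_derivative \<Psi> (at q)" for q
  have \<Psi>: "Ck_on k (I \<times> D) \<Psi>" for k
    using var unfolding smooth_variation_def smooth_on_def I_def \<Psi>_def by blast
  have \<Phi>0: "\<Phi> 0 p = \<phi> p" if "p \<in> D" for p
    using var that unfolding smooth_variation_def \<phi>_def by blast
  have \<Phi>K: "\<Phi> s p = \<phi> p" if "s \<in> I" "p \<in> D - K" for s p
    using var that unfolding smooth_variation_def \<phi>_def I_def by blast
  have "0 \<in> I" using \<open>0 < \<epsilon>\<close> by (simp add: I_def)

  have d\<Phi>: "(\<Phi> s has_derivative (\<lambda>h. E (s, p) (0, h))) (at p)" if "s \<in> I" "p \<in> D" for s p
  proof -
    have "(\<Psi> has_derivative E (s, p)) (at (s, p))"
      unfolding E_def using that by (intro Ck_on_1_has_derivative[OF \<Psi>]) auto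
    from has_derivative_compose[OF has_derivative_Pair[OF has_derivative_const has_derivative_ident] this]
    show ?thesis by (simp add: \<Psi>_def)
  qed
  have d\<phi>: "(\<phi> has_derivative (\<lambda>h. E (0, p) (0, h))) (at p)" if "p \<in> D" for p
    using \<Phi>0 by (intro has_derivative_transform_within_open[OF d\<Phi>[OF \<open>0 \<in> I\<close> that] \<open>open D\<close> that])
  have E0: "E (0, p) (0, h) = (\<xi>0 p * fst h + \<eta>0 p * snd h,
      exp (\<mu>1 * x0 p) * \<xi>1 p * fst h + exp (\<mu>1 * x0 p) * \<eta>1 p * snd h,
      exp (\<mu>2 * x0 p) * \<xi>2 p * fst h + exp (\<mu>2 * x0 p) * \<eta>2 p * snd h)" if p: "p \<in> D" for p h
  proof -
    have "(\<phi> has_derivative (\<lambda>h. (\<xi>0 p * fst h + \<eta>0 p * snd h,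
      exp (\<mu>1 * x0 p) * \<xi>1 p * fst h + exp (\<mu>1 * x0 p) * \<eta>1 p * snd h,
      exp (\<mu>2 * x0 p) * \<xi>2 p * fst h + exp (\<mu>2 * x0 p) * \<eta>2 p * snd h))) (at p)"
      unfolding \<phi>_def by (intro has_derivative_Pair dx0 dx1 dx2 p)
    from has_derivative_unique[OF d\<phi>[OF p] this] show ?thesis by meson
  qed
  have C1E: "Ck_on 1 (I \<times> D) (\<lambda>q. E q h)" for h
    using \<Psi>[of "Suc 1"] unfolding E_def Ck_on.simps(2) by blast
  have cE: "continuous_on D (\<lambda>p. E (s, p) h)" if "s \<in> I" for s h
    using Ck_on_imp_continuous_on[OF Ck_on_slice[OF \<open>open D\<close> that C1E]] .
  have c\<Phi>: "continuous_on D (\<Phi> s)" if "s \<in> I" for s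
    using Ck_on_imp_continuous_on[OF Ck_on_slice[OF \<open>open D\<close> that \<Psi>[of 0]]] by (simp add: \<Psi>_def)

  \<comment> \<open>\<open>L s\<close> is the energy density of \<open>\<Phi> s\<close>, as a function on the \<open>(u, v)\<close>-plane.\<close>
  define L where "L s p = 2 * G_metric \<mu>1 \<mu>2 (\<Phi> s p) (E (s, p) (0, (1, 0))) (E (s, p) (0, (0, 1)))" for s p
  define N where "N = null_coords -` K"
  have compN: "compact N" unfolding N_def by (rule compact_vimage_null_coords[OF K(1)])
  have inD: "null_coords q \<in> D" if "q \<in> N" for q using that K(2) by (auto simp: N_def)
  have energy: "energy \<mu>1 \<mu>2 K (\<Phi> s) = integral N (\<lambda>q. L s (null_coords q))" if "s \<in> I" for s
    unfolding energy_def N_def[symmetric]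
    by (rule integral_cong) (simp add: L_def energy_density_null_coords[OF d\<Phi>[OF that inD]])
  have contL: "continuous_on D (L s)" if "s \<in> I" for s
    unfolding L_def G_metric_eq by (intro continuous_intros c\<Phi> cE that)
  have contN: "continuous_on N (\<lambda>q. f (null_coords q))" if "continuous_on D f" for f :: "real \<times> real \<Rightarrow> real"
    by (rule continuous_on_compose2[OF that linear_continuous_on[OF bounded_linear_null_coords]])
      (use inD in auto)
  have intL: "(\<lambda>q. L s (null_coords q)) integrable_on N" if "s \<in> I" for s
    by (rule integrable_on_compact_continuous[OF compN contN[OF contL[OF that]]])

  \<comment> \<open>The variation as a finite difference \<open>\<Phi> s - \<phi>\<close>, and \<open>\<Delta> h s\<close>, its derivative in direction \<open>h\<close>.\<close>
  define V0 where "V0 s p = fst (\<Phi> s p) - x0 p" for s p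
  define V1 where "V1 s p = fst (snd (\<Phi> s p)) - x1 p" for s p
  define V2 where "V2 s p = snd (snd (\<Phi> s p)) - x2 p" for s p
  define \<Delta> where "\<Delta> h s p = E (s, p) (0, h) - E (0, p) (0, h)" for h s p
  have bl: "bounded_linear (\<lambda>x::G. fst x)" "bounded_linear (\<lambda>x::G. fst (snd x))" "bounded_linear (\<lambda>x::G. snd (snd x))"
    by (intro bounded_linear_fst bounded_linear_fst_comp bounded_linear_snd_comp bounded_linear_snd)+
  have \<phi>_comp: "x0 p = fst (\<phi> p)" "x1 p = fst (snd (\<phi> p))" "x2 p = snd (snd (\<phi> p))" for p
    by (simp_all add: \<phi>_def)
  have C\<phi>: "Ck_on k D \<phi>" for k using smooth unfolding smooth_on_def \<phi>_def by blast
  have C\<Phi>: "Ck_on k D (\<Phi> s)" if "s \<in> I" for s k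
    using Ck_on_slice[OF \<open>open D\<close> that \<Psi>] by (simp add: \<Psi>_def)
  have C1V: "Ck_on 1 D (V0 s)" "Ck_on 1 D (V1 s)" "Ck_on 1 D (V2 s)" if "s \<in> I" for s
    unfolding V0_def[abs_def] V1_def[abs_def] V2_def[abs_def] \<phi>_comp
    by (intro Ck_on_diff[OF \<open>open D\<close>] Ck_on_bounded_linear[OF \<open>open D\<close> bl(1)] Ck_on_bounded_linear[OF \<open>open D\<close> bl(2)]
       Ck_on_bounded_linear[OF \<open>open D\<close> bl(3)] C\<Phi> C\<phi> that)+
  have dV: "(V0 s has_derivative (\<lambda>h. fst (\<Delta> h s p))) (at p)"
    "(V1 s has_derivative (\<lambda>h. fst (snd (\<Delta> h s p)))) (at p)"
    "(V2 s has_derivative (\<lambda>h. snd (snd (\<Delta> h s p)))) (at p)" if "s \<in> I" "p \<in> D" for s p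
  proof -
    from has_derivative_diff[OF d\<Phi>[OF that] d\<phi>[OF that(2)]]
    have d: "((\<lambda>p. \<Phi> s p - \<phi> p) has_derivative (\<lambda>h. \<Delta> h s p)) (at p)"
      by (simp add: \<Delta>_def)
    show "(V0 s has_derivative (\<lambda>h. fst (\<Delta> h s p))) (at p)"
      "(V1 s has_derivative (\<lambda>h. fst (snd (\<Delta> h s p)))) (at p)"
      "(V2 s has_derivative (\<lambda>h. snd (snd (\<Delta> h s p)))) (at p)"
      using bl[THEN bounded_linear.has_derivative, OF d]
      by (simp_all add: V0_def[abs_def] V1_def[abs_def] V2_def[abs_def] \<phi>_def)
  qed
  have VK: "V0 s p = 0" "V1 s p = 0" "V2 s p = 0" if "s \<in> I" "p \<in> D - K" for s p
    using \<Phi>K[OF that] by (simp_all add: V0_def V1_def V2_def \<phi>_def)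
  let ?u = "(1, 0) :: real \<times> real" and ?v = "(0, 1) :: real \<times> real"

  define T where "T c \<mu> v w p = c * exp (- \<mu> * x0 p) * v p * w p"
    for c \<mu> :: real and v w :: "real \<times> real \<Rightarrow> real" and p
  \<comment> \<open>The field whose divergence is the part of \<open>L s - L 0\<close> linear in the variation. The signs and the factor 2
    are those of \<open>2 \<langle>\<phi>\<^sub>u, \<phi>\<^sub>v\<rangle>\<close>; in the time component the metric coefficient is the constant -1, hence the exponent 0.\<close>
  define X where "X s p = T (-2) 0 (V0 s) \<eta>0 p + T 2 \<mu>1 (V1 s) \<eta>1 p + T 2 \<mu>2 (V2 s) \<eta>2 p" for s p
  define Y where "Y s p = T (-2) 0 (V0 s) \<xi>0 p + T 2 \<mu>1 (V1 s) \<xi>1 p + T 2 \<mu>2 (V2 s) \<xi>2 p" for s p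
  have Cx0: "Ck_on 1 D x0" unfolding \<phi>_comp using Ck_on_bounded_linear[OF \<open>open D\<close> bl(1) C\<phi>] .
  have CT: "Ck_on 1 D (T c \<mu> v w)" if "Ck_on 1 D v" "Ck_on 1 D w" for c \<mu> v w
    unfolding T_def[abs_def]
    by (intro Ck_on_mult[OF \<open>open D\<close>] Ck_on_exp[OF \<open>open D\<close>] Ck_on_const Cx0 that)
  have CXY: "Ck_on 1 D (X s)" "Ck_on 1 D (Y s)" if "s \<in> I" for s
    unfolding X_def[abs_def] Y_def[abs_def]
    by (intro Ck_on_add[OF \<open>open D\<close>] CT C1V C1 that)+
  have div0: "((\<lambda>q. partial1 (X s) (null_coords q) + partial2 (Y s) (null_coords q)) has_integral 0) N"
    if "s \<in> I" for s
    unfolding N_def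
    by (rule has_integral_null_divergence[OF \<open>open D\<close> K CXY[OF that]])
      (use VK[OF that] in \<open>simp_all add: X_def Y_def T_def\<close>)
  have div: "partial1 (X s) p + partial2 (Y s) p =
      - 2 * (fst (\<Delta> ?u s p) * \<eta>0 p + fst (\<Delta> ?v s p) * \<xi>0 p + V0 s p * (2 * (\<mu>1 * \<xi>1 p * \<eta>1 p + \<mu>2 * \<xi>2 p * \<eta>2 p)))
      + 2 * exp (- \<mu>1 * x0 p) * (fst (snd (\<Delta> ?u s p)) * \<eta>1 p + fst (snd (\<Delta> ?v s p)) * \<xi>1 p)
      + 2 * exp (- \<mu>2 * x0 p) * (snd (snd (\<Delta> ?u s p)) * \<eta>2 p + snd (snd (\<Delta> ?v s p)) * \<xi>2 p)"
    if s: "s \<in> I" and p: "p \<in> D" for s p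
  proof -
    note diffs = C1V[OF s, THEN Ck_on_1_differentiable, OF p] C1[THEN Ck_on_1_differentiable, OF p]
    have Td: "T c \<mu> v w differentiable (at p)" if "Ck_on 1 D v" "Ck_on 1 D w" for c \<mu> v w
      using CT[OF that] p by (rule Ck_on_1_differentiable)
    have dT: "partial1 (T c \<mu> v \<eta>) p + partial2 (T c \<mu> v \<xi>) p
      = c * exp (- \<mu> * x0 p) * (partial1 v p * \<eta> p + partial2 v p * \<xi> p
        + v p * (partial1 \<eta> p + partial2 \<xi> p - \<mu> * (\<xi>0 p * \<eta> p + \<eta>0 p * \<xi> p)))"
      if "v differentiable (at p)" "\<eta> differentiable (at p)" "\<xi> differentiable (at p)" for c \<mu> v \<eta> \<xi>
      unfolding T_def[abs_def] by (rule divergence_exp_weighted[where a=\<xi>0 and b=\<eta>0, OF _ that]) (rule dx0[OF p])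
    have "partial1 (X s) p + partial2 (Y s) p
      = (partial1 (T (-2) 0 (V0 s) \<eta>0) p + partial2 (T (-2) 0 (V0 s) \<xi>0) p)
      + (partial1 (T 2 \<mu>1 (V1 s) \<eta>1) p + partial2 (T 2 \<mu>1 (V1 s) \<xi>1) p)
      + (partial1 (T 2 \<mu>2 (V2 s) \<eta>2) p + partial2 (T 2 \<mu>2 (V2 s) \<xi>2) p)"
      unfolding X_def[abs_def] Y_def[abs_def]
      by (simp add: partial_add Td[OF C1V(1)[OF s] C1(1)] Td[OF C1V(2)[OF s] C1(2)] Td[OF C1V(3)[OF s] C1(3)]
          Td[OF C1V(1)[OF s] C1(4)] Td[OF C1V(2)[OF s] C1(5)] Td[OF C1V(3)[OF s] C1(6)] differentiable_add)
    also have "\<dots> = - 2 * (partial1 (V0 s) p * \<eta>0 p + partial2 (V0 s) p * \<xi>0 p + V0 s p * (2 * (\<mu>1 * \<xi>1 p * \<eta>1 p + \<mu>2 * \<xi>2 p * \<eta>2 p)))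
      + 2 * exp (- \<mu>1 * x0 p) * (partial1 (V1 s) p * \<eta>1 p + partial2 (V1 s) p * \<xi>1 p)
      + 2 * exp (- \<mu>2 * x0 p) * (partial1 (V2 s) p * \<eta>2 p + partial2 (V2 s) p * \<xi>2 p)"
      unfolding dT[OF diffs(1,7,4)] dT[OF diffs(2,8,5)] dT[OF diffs(3,9,6)] eq0[OF p] eq1[OF p] eq2[OF p]
      by simp
    finally show ?thesis
      by (simp only: partial1_eq[OF dV(1)[OF s p]] partial1_eq[OF dV(2)[OF s p]] partial1_eq[OF dV(3)[OF s p]]
        partial2_eq[OF dV(1)[OF s p]] partial2_eq[OF dV(2)[OF s p]] partial2_eq[OF dV(3)[OF s p]])
  qed

  \<comment> \<open>The time component has constant metric coefficient, hence \<open>e = - 1\<close> and \<open>y = 0\<close> in its remainder.\<close>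
  define R0 where "R0 s p = second_order_remainder (- 1) 0 (\<xi>0 p) (\<eta>0 p) (fst (\<Delta> ?u s p)) (fst (\<Delta> ?v s p))" for s p
  define R1 where "R1 s p = second_order_remainder (exp (- 2 * \<mu>1 * x0 p)) (- 2 * \<mu>1 * V0 s p) (exp (\<mu>1 * x0 p) * \<xi>1 p) (exp (\<mu>1 * x0 p) * \<eta>1 p)
           (fst (snd (\<Delta> ?u s p))) (fst (snd (\<Delta> ?v s p)))" for s p
  define R2 where "R2 s p = second_order_remainder (exp (- 2 * \<mu>2 * x0 p)) (- 2 * \<mu>2 * V0 s p) (exp (\<mu>2 * x0 p) * \<xi>2 p) (exp (\<mu>2 * x0 p) * \<eta>2 p)
           (snd (snd (\<Delta> ?u s p))) (snd (snd (\<Delta> ?v s p)))" for s p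
  have split: "L s p - L 0 p - (partial1 (X s) p + partial2 (Y s) p) =
      2 * (R0 s p + R1 s p + R2 s p)"
    if s: "s \<in> I" and p: "p \<in> D" for s p
  proof -
    have E: "E (s, p) (0, h) = E (0, p) (0, h) + \<Delta> h s p" for h by (simp add: \<Delta>_def)
    have \<Phi>: "fst (\<Phi> s p) = x0 p + V0 s p" by (simp add: V0_def)
    have 0: "fst (\<Phi> 0 p) = x0 p" using \<Phi>0[OF p] by (simp add: \<phi>_def)
    have t1: "exp (- 2 * \<mu>1 * (x0 p + V0 s p)) * ((exp (\<mu>1 * x0 p) * \<xi>1 p + fst (snd (\<Delta> ?u s p))) * (exp (\<mu>1 * x0 p) * \<eta>1 p + fst (snd (\<Delta> ?v s p))))
        = R1 s p
         + exp (- 2 * \<mu>1 * x0 p) * ((exp (\<mu>1 * x0 p) * \<xi>1 p) * (exp (\<mu>1 * x0 p) * \<eta>1 p))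
         + (exp (- \<mu>1 * x0 p) * (fst (snd (\<Delta> ?u s p)) * \<eta>1 p + fst (snd (\<Delta> ?v s p)) * \<xi>1 p) - 2 * \<mu>1 * V0 s p * \<xi>1 p * \<eta>1 p)"
      unfolding R1_def using G_metric_term_expansion[of \<mu>1 "x0 p" "V0 s p" "\<xi>1 p" "fst (snd (\<Delta> ?u s p))" "\<eta>1 p" "fst (snd (\<Delta> ?v s p))"] by linarith
    have t2: "exp (- 2 * \<mu>2 * (x0 p + V0 s p)) * ((exp (\<mu>2 * x0 p) * \<xi>2 p + snd (snd (\<Delta> ?u s p))) * (exp (\<mu>2 * x0 p) * \<eta>2 p + snd (snd (\<Delta> ?v s p))))
        = R2 s p
         + exp (- 2 * \<mu>2 * x0 p) * ((exp (\<mu>2 * x0 p) * \<xi>2 p) * (exp (\<mu>2 * x0 p) * \<eta>2 p))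
         + (exp (- \<mu>2 * x0 p) * (snd (snd (\<Delta> ?u s p)) * \<eta>2 p + snd (snd (\<Delta> ?v s p)) * \<xi>2 p) - 2 * \<mu>2 * V0 s p * \<xi>2 p * \<eta>2 p)"
      unfolding R2_def using G_metric_term_expansion[of \<mu>2 "x0 p" "V0 s p" "\<xi>2 p" "snd (snd (\<Delta> ?u s p))" "\<eta>2 p" "snd (snd (\<Delta> ?v s p))"] by linarith
    show ?thesis
      unfolding div[OF s p] L_def G_metric_eq E E0[OF p] \<Phi> 0 
      by (simp only: fst_conv snd_conv fst_add snd_add mult_1_right mult_zero_right add_0_left add_0_right t1 t2)
        (simp add: R0_def second_order_remainder_def algebra_simps)
  qed
  \<comment> \<open>\<open>\<delta> < \<epsilon>\<close> keeps \<open>{-\<delta>..\<delta>} \<times> K\<close> inside the domain of the variation; \<open>\<delta> \<le> 1\<close> is needed for the remainder bound.\<close>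
  define \<delta> where "\<delta> = min 1 (\<epsilon> / 2)"
  have \<delta>: "0 < \<delta>" "\<delta> < \<epsilon>" "\<delta> \<le> 1" using \<open>0 < \<epsilon>\<close> by (auto simp: \<delta>_def)
  have \<delta>I: "s \<in> I" if "\<bar>s\<bar> \<le> \<delta>" for s using that \<delta> by (auto simp: I_def)
  have incr: "\<exists>C. \<forall>s p. \<bar>s\<bar> \<le> \<delta> \<longrightarrow> p \<in> K \<longrightarrow> norm (g (s, p) - g (0, p)) \<le> C * \<bar>s\<bar>"
    if "Ck_on 1 (I \<times> D) g" for g :: "real \<times> real \<times> real \<Rightarrow> G"
    using that K \<delta>(1,2) unfolding I_def by (rule uniform_increment_bound)
  have comps: "\<bar>fst x\<bar> \<le> norm x" "\<bar>fst (snd x)\<bar> \<le> norm x" "\<bar>snd (snd x)\<bar> \<le> norm x" for x :: G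
    using norm_fst_le[of "fst x" "snd x"] norm_snd_le[of "snd x" "fst x"]
      norm_fst_le[of "fst (snd x)" "snd (snd x)"] norm_snd_le[of "snd (snd x)" "fst (snd x)"] by auto
  have \<Delta>b: "\<exists>C. \<forall>s p. \<bar>s\<bar> \<le> \<delta> \<longrightarrow> p \<in> K \<longrightarrow> \<bar>fst (\<Delta> h s p)\<bar> \<le> C * \<bar>s\<bar>"
    "\<exists>C. \<forall>s p. \<bar>s\<bar> \<le> \<delta> \<longrightarrow> p \<in> K \<longrightarrow> \<bar>fst (snd (\<Delta> h s p))\<bar> \<le> C * \<bar>s\<bar>"
    "\<exists>C. \<forall>s p. \<bar>s\<bar> \<le> \<delta> \<longrightarrow> p \<in> K \<longrightarrow> \<bar>snd (snd (\<Delta> h s p))\<bar> \<le> C * \<bar>s\<bar>" for h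
    using incr[OF C1E[of "(0, h)"]] comps order_trans unfolding \<Delta>_def[symmetric] by meson+
  obtain CV where CV: "\<And>s p. \<bar>s\<bar> \<le> \<delta> \<Longrightarrow> p \<in> K \<Longrightarrow> norm (\<Phi> s p - \<Phi> 0 p) \<le> CV * \<bar>s\<bar>"
    using incr[OF \<Psi>[of 1]] by (auto simp: \<Psi>_def)
  have V0b: "\<bar>V0 s p\<bar> \<le> CV * \<bar>s\<bar>" if "\<bar>s\<bar> \<le> \<delta>" "p \<in> K" for s p
  proof -
    have "V0 s p = fst (\<Phi> s p - \<Phi> 0 p)" using \<Phi>0[of p] that K(2) by (auto simp: V0_def \<phi>_def)
    then show ?thesis using CV[OF that] comps(1)[of "\<Phi> s p - \<Phi> 0 p"] by simp
  qed
  have Vb: "\<exists>C. \<forall>s p. \<bar>s\<bar> \<le> \<delta> \<longrightarrow> p \<in> K \<longrightarrow> \<bar>m * V0 s p\<bar> \<le> C * \<bar>s\<bar>" for m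
    using V0b by (intro exI[of _ "\<bar>m\<bar> * CV"]) (auto simp: abs_mult mult.assoc intro!: mult_left_mono)
  have contK: "continuous_on K f" if "Ck_on 1 D f" for f :: "real \<times> real \<Rightarrow> real"
    using Ck_on_imp_continuous_on[OF that] K(2) continuous_on_subset by blast
  note c = C1[THEN contK] contK[OF Cx0]
  have "\<exists>C. \<forall>s p. \<bar>s\<bar> \<le> \<delta> \<longrightarrow> p \<in> K \<longrightarrow> \<bar>R0 s p\<bar> \<le> C * s\<^sup>2"
    unfolding R0_def
    by (rule exp_product_remainder_uniform[OF K(1) _ _ _ \<delta>(3) \<Delta>b(1) \<Delta>b(1)])
      (intro continuous_intros c | simp add: exI[of _ 0])+
  moreover have "\<exists>C. \<forall>s p. \<bar>s\<bar> \<le> \<delta> \<longrightarrow> p \<in> K \<longrightarrow> \<bar>R1 s p\<bar> \<le> C * s\<^sup>2"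
    unfolding R1_def
    by (rule exp_product_remainder_uniform[OF K(1) _ _ _ \<delta>(3) \<Delta>b(2) \<Delta>b(2) Vb])
      (intro continuous_intros c)+
  moreover have "\<exists>C. \<forall>s p. \<bar>s\<bar> \<le> \<delta> \<longrightarrow> p \<in> K \<longrightarrow> \<bar>R2 s p\<bar> \<le> C * s\<^sup>2"
    unfolding R2_def
    by (rule exp_product_remainder_uniform[OF K(1) _ _ _ \<delta>(3) \<Delta>b(3) \<Delta>b(3) Vb])
      (intro continuous_intros c)+
  ultimately obtain C0 C1 C2 where C: "\<And>s p. \<bar>s\<bar> \<le> \<delta> \<Longrightarrow> p \<in> K \<Longrightarrow> \<bar>R0 s p\<bar> \<le> C0 * s\<^sup>2"
    "\<And>s p. \<bar>s\<bar> \<le> \<delta> \<Longrightarrow> p \<in> K \<Longrightarrow> \<bar>R1 s p\<bar> \<le> C1 * s\<^sup>2"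
    "\<And>s p. \<bar>s\<bar> \<le> \<delta> \<Longrightarrow> p \<in> K \<Longrightarrow> \<bar>R2 s p\<bar> \<le> C2 * s\<^sup>2"
    by metis
  define C where "C = 2 * (C0 + C1 + C2)"
  have rem: "\<bar>L s p - L 0 p - (partial1 (X s) p + partial2 (Y s) p)\<bar> \<le> C * s\<^sup>2"
    if "\<bar>s\<bar> \<le> \<delta>" "p \<in> K" for s p
  proof -
    have "p \<in> D" using that K(2) by blast
    show ?thesis
      unfolding split[OF \<delta>I[OF that(1)] \<open>p \<in> D\<close>] C_def
      using C[OF that] by (simp only: distrib_right distrib_left mult.assoc)
  qed
  show "((\<lambda>s. energy \<mu>1 \<mu>2 K (\<Phi> s)) has_real_derivative 0) (at 0)"
  proof (rule has_derivative_zero_if_quadratic_bound[OF \<delta>(1)])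
    fix s :: real assume s: "\<bar>s\<bar> \<le> \<delta>"
    note sI = \<delta>I[OF s]
    let ?f = "\<lambda>q. L s (null_coords q) - L 0 (null_coords q)
        - (partial1 (X s) (null_coords q) + partial2 (Y s) (null_coords q))"
    have f: "(?f has_integral (energy \<mu>1 \<mu>2 K (\<Phi> s) - energy \<mu>1 \<mu>2 K (\<Phi> 0) - 0)) N"
      unfolding energy[OF sI] energy[OF \<open>0 \<in> I\<close>]
      by (intro has_integral_diff integrable_integral intL sI \<open>0 \<in> I\<close> div0)
    have const: "(\<lambda>q. C * s\<^sup>2 * 1) integrable_on N"
      by (rule integrable_on_compact_continuous[OF compN]) simp
    have "norm (integral N ?f) \<le> integral N (\<lambda>q. C * s\<^sup>2 * 1)"
      by (rule integral_norm_bound_integral)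
        (use f const rem[OF s] in \<open>auto simp: N_def has_integral_iff\<close>)
    also have "\<dots> = C * s\<^sup>2 * integral N (\<lambda>q. 1)"
      by (rule integral_mult_right)
    finally show "\<bar>energy \<mu>1 \<mu>2 K (\<Phi> s) - energy \<mu>1 \<mu>2 K (\<Phi> 0)\<bar> \<le> (C * integral N (\<lambda>q. 1)) * s\<^sup>2"
      using integral_unique[OF f] by (simp add: mult.commute mult.left_commute)
  qed
qed


section \<open>The integral formula\<close>

theorem proposition2p1:
  fixes \<mu>1 \<mu>2 :: real and D :: "(real \<times> real) set"
    and \<xi>0 \<xi>1 \<xi>2 \<eta>0 \<eta>1 \<eta>2 :: "real \<times> real \<Rightarrow> real"
    and \<omega>0' \<omega>1' \<omega>2' \<omega>0'' \<omega>1'' \<omega>2'' :: one_form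
    and p0 :: "real \<times> real" and c :: G
  assumes "open D" "connected D" "simply_connected D"
    and "smooth_on D \<xi>0" "smooth_on D \<xi>1" "smooth_on D \<xi>2"
    and "smooth_on D \<eta>0" "smooth_on D \<eta>1" "smooth_on D \<eta>2"
    and "\<omega>0' = form_du \<xi>0" "\<omega>1' = form_du \<xi>1" "\<omega>2' = form_du \<xi>2"
    and "\<omega>0'' = form_dv \<eta>0" "\<omega>1'' = form_dv \<eta>1" "\<omega>2'' = form_dv \<eta>2"
    and "\<forall>p\<in>D. d'' \<omega>0' p = \<mu>1 * wedge \<omega>1'' \<omega>1' p + \<mu>2 * wedge \<omega>2'' \<omega>2' p"
    and "\<forall>p\<in>D. d'' \<omega>1' p = \<mu>1 * wedge \<omega>1'' \<omega>0' p"
    and "\<forall>p\<in>D. d'' \<omega>2' p = \<mu>2 * wedge \<omega>2'' \<omega>0' p"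
    and "\<forall>p\<in>D. d' \<omega>0'' p = \<mu>1 * wedge \<omega>1' \<omega>1'' p + \<mu>2 * wedge \<omega>2' \<omega>2'' p"
    and "\<forall>p\<in>D. d' \<omega>1'' p = \<mu>1 * wedge \<omega>1' \<omega>0'' p"
    and "\<forall>p\<in>D. d' \<omega>2'' p = \<mu>2 * wedge \<omega>2' \<omega>0'' p"
    and "p0 \<in> D"
  shows "\<exists>\<phi>. given_by_formula \<mu>1 \<mu>2 D p0 c \<omega>0' \<omega>1' \<omega>2' \<omega>0'' \<omega>1'' \<omega>2'' \<phi> \<and>
             harmonic_map \<mu>1 \<mu>2 D \<phi> \<and>
             (\<forall>\<phi>'. given_by_formula \<mu>1 \<mu>2 D p0 c \<omega>0' \<omega>1' \<omega>2' \<omega>0'' \<omega>1'' \<omega>2'' \<phi>' \<longrightarrow>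
                (\<forall>p\<in>D. \<phi>' p = \<phi> p))"
proof -
  note smooth = assms(4-9)
  note \<omega> = assms(10-15)
  have C1: "Ck_on 1 D f" if "smooth_on D f" for f :: "real \<times> real \<Rightarrow> real"
    using that unfolding smooth_on_def by blast
  have pde_v: "partial2 \<xi>0 p = \<mu>1 * \<xi>1 p * \<eta>1 p + \<mu>2 * \<xi>2 p * \<eta>2 p"
    "partial2 \<xi>1 p = \<mu>1 * \<xi>0 p * \<eta>1 p" "partial2 \<xi>2 p = \<mu>2 * \<xi>0 p * \<eta>2 p"
    and pde_u: "partial1 \<eta>0 p = \<mu>1 * \<xi>1 p * \<eta>1 p + \<mu>2 * \<xi>2 p * \<eta>2 p"
    "partial1 \<eta>1 p = \<mu>1 * \<xi>1 p * \<eta>0 p" "partial1 \<eta>2 p = \<mu>2 * \<xi>2 p * \<eta>0 p" if "p \<in> D" for p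
    using assms(16-21)[THEN bspec, OF that]
    by (simp_all add: \<omega> d''_def d'_def wedge_def form_du_def form_dv_def algebra_simps)

  \<comment> \<open>The equations for \<open>\<omega>0\<close> give equal mixed derivatives, so \<open>\<omega>0' + \<omega>0''\<close> is closed.\<close>
  obtain x0 where x0: "x0 p0 = fst c"
    and dx0: "\<And>p. p \<in> D \<Longrightarrow> (x0 has_derivative (\<lambda>h. \<xi>0 p * fst h + \<eta>0 p * snd h)) (at p)"
    using closed_form_exact[OF assms(1,3) smooth(1,4)[THEN C1], of p0 "fst c"] pde_u(1) pde_v(1) by auto
  have sx0: "smooth_on D x0" by (rule smooth_on_gradient[OF assms(1) smooth(1,4) dx0])
  \<comment> \<open>The factor \<open>exp (\<mu> x0)\<close> contributes \<open>\<mu> \<eta>0 \<xi>\<close> to the \<open>v\<close>-derivative and \<open>\<mu> \<xi>0 \<eta>\<close> to the \<open>u\<close>-derivative;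
    together with the equations this makes the form closed.\<close>
  have frame: "\<exists>x. x p0 = k \<and> smooth_on D x \<and> (\<forall>p\<in>D. (x has_derivative
        (\<lambda>h. exp (\<mu> * x0 p) * \<xi> p * fst h + exp (\<mu> * x0 p) * \<eta> p * snd h)) (at p))"
    if s: "smooth_on D \<xi>" "smooth_on D \<eta>"
      and pde: "\<And>p. p \<in> D \<Longrightarrow> partial2 \<xi> p = \<mu> * \<xi>0 p * \<eta> p" "\<And>p. p \<in> D \<Longrightarrow> partial1 \<eta> p = \<mu> * \<xi> p * \<eta>0 p"
    for \<mu> \<xi> \<eta> and k :: real
  proof -
    note se = smooth_on_exp_mult[OF assms(1) sx0 s(1), of \<mu>] smooth_on_exp_mult[OF assms(1) sx0 s(2), of \<mu>]
    have "partial2 (\<lambda>p. exp (\<mu> * x0 p) * \<xi> p) p = partial1 (\<lambda>p. exp (\<mu> * x0 p) * \<eta> p) p" if p: "p \<in> D" for p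
      using s[THEN C1, THEN Ck_on_1_differentiable, OF p] pde[OF p]
      by (simp add: partial_exp_mult[where a=\<xi>0 and b=\<eta>0, OF dx0[OF p]])
    then obtain x where "x p0 = k" and dx: "\<And>p. p \<in> D \<Longrightarrow> (x has_derivative
        (\<lambda>h. exp (\<mu> * x0 p) * \<xi> p * fst h + exp (\<mu> * x0 p) * \<eta> p * snd h)) (at p)"
      using closed_form_exact[OF assms(1,3) se[THEN C1], of p0 k] by blast
    moreover have "smooth_on D x" by (rule smooth_on_gradient[OF assms(1) se dx])
    ultimately show ?thesis by blast
  qed
  obtain x1 where x1: "x1 p0 = fst (snd c)" "smooth_on D x1"
    and dx1: "\<And>p. p \<in> D \<Longrightarrow> (x1 has_derivative
        (\<lambda>h. exp (\<mu>1 * x0 p) * \<xi>1 p * fst h + exp (\<mu>1 * x0 p) * \<eta>1 p * snd h)) (at p)"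
    using frame[OF smooth(2,5) pde_v(2) pde_u(2), of "fst (snd c)"] by blast
  obtain x2 where x2: "x2 p0 = snd (snd c)" "smooth_on D x2"
    and dx2: "\<And>p. p \<in> D \<Longrightarrow> (x2 has_derivative
        (\<lambda>h. exp (\<mu>2 * x0 p) * \<xi>2 p * fst h + exp (\<mu>2 * x0 p) * \<eta>2 p * snd h)) (at p)"
    using frame[OF smooth(3,6) pde_v(3) pde_u(3), of "snd (snd c)"] by blast
  define \<phi> where "\<phi> = (\<lambda>p. (x0 p, x1 p, x2 p))"

  have "is_integral_from D p0 (x0 p0) (\<lambda>p. \<omega>0' p + \<omega>0'' p) x0"
    by (rule is_integral_from_gradient) (use dx0 in \<open>simp add: \<omega> form_du_def form_dv_def inner_prod_def\<close>)
  moreover have "is_integral_from D p0 (x1 p0) (\<lambda>p. exp (\<mu>1 * x0 p) *\<^sub>R (\<omega>1' p + \<omega>1'' p)) x1"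
    by (rule is_integral_from_gradient) (use dx1 in \<open>simp add: \<omega> form_du_def form_dv_def inner_prod_def\<close>)
  moreover have "is_integral_from D p0 (x2 p0) (\<lambda>p. exp (\<mu>2 * x0 p) *\<^sub>R (\<omega>2' p + \<omega>2'' p)) x2"
    by (rule is_integral_from_gradient) (use dx2 in \<open>simp add: \<omega> form_du_def form_dv_def inner_prod_def\<close>)
  ultimately have formula: "given_by_formula \<mu>1 \<mu>2 D p0 c \<omega>0' \<omega>1' \<omega>2' \<omega>0'' \<omega>1'' \<omega>2'' \<phi>"
    by (simp add: given_by_formula_def \<phi>_def x0 x1 x2)

  have "smooth_on D (\<lambda>p. (x0 p, x1 p, x2 p))"
    using sx0 x1(2) x2(2) unfolding smooth_on_def by (intro allI Ck_on_Pair[OF assms(1)]) blast+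
  then have harmonic: "harmonic_map \<mu>1 \<mu>2 D \<phi>"
    unfolding \<phi>_def
    by (rule harmonic_map_of_null_frame[OF assms(1) _ smooth[THEN C1] dx0 dx1 dx2])
      (simp_all add: pde_u pde_v algebra_simps)

  \<comment> \<open>The first components agree first; then the weights \<open>exp (\<mu>i x0)\<close> in the other two integrals agree.\<close>
  have "\<phi>' p = \<phi> p" if \<phi>': "given_by_formula \<mu>1 \<mu>2 D p0 c \<omega>0' \<omega>1' \<omega>2' \<omega>0'' \<omega>1'' \<omega>2'' \<phi>'" and p: "p \<in> D" for \<phi>' p
  proof -
    note unique = is_integral_from_unique[OF assms(1,2,22)]
    note f = formula[unfolded given_by_formula_def Let_def] \<phi>'[unfolded given_by_formula_def Let_def]
    have 0: "fst (\<phi>' q) = fst (\<phi> q)" if "q \<in> D" for q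
      by (rule unique[OF that f(2)[THEN conjunct1] f(1)[THEN conjunct1]]) simp
    have "fst (snd (\<phi>' p)) = fst (snd (\<phi> p))"
      by (rule unique[OF p f(2)[THEN conjunct2, THEN conjunct1] f(1)[THEN conjunct2, THEN conjunct1]]) (simp add: 0)
    moreover have "snd (snd (\<phi>' p)) = snd (snd (\<phi> p))"
      by (rule unique[OF p f(2)[THEN conjunct2, THEN conjunct2] f(1)[THEN conjunct2, THEN conjunct2]]) (simp add: 0)
    ultimately show ?thesis using 0[OF p] by (simp add: prod_eq_iff)
  qed
  with formula harmonic show ?thesis by blast
qed

end
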